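(* Let $1\le s\le p-1$. The elements $e^{+}(s,t)$ for $1\le t\le s$ together with $e^{-}(p-s,u)$ for $1\le u\le p-s$ are mutually orthogonal primitive idempotents of $Q_s$.
   Context: Let $p\ge 2$ be an integer and $q=\exp(\pi\sqrt{-1}/p)$. $\overline{U}_q(sl_2)$ is the associative unital $\mathbb{C}$-algebra generated by $E,F,K,K^{-1}$ with relations $KK^{-1}=K^{-1}K=1$, $KEK^{-1}=q^2E$, $KFK^{-1}=q^{-2}F$, $EF-FE=\frac{K-K^{-1}}{q-q^{-1}}$, $E^p=F^p=0$, $K^{2p}=1$. Write $[n]=\frac{q^n-q^{-n}}{q-q^{-1}}$. Empty products are $1$ and empty sums are $0$. A sign $\alpha\in\{+,-\}$ is identified with $\pm1$. The Casimir element $C=EF+\frac{q^{-1}K+qK^{-1}}{(q-q^{-1})^2}$ is central, and $\overline{U}_q(sl_2)=\bigoplus_{s=0}^pQ_s$ as algebras, where $Q_s$ is the generalized eigenspace of (multiplication by) $C$ with eigenvalue $\frac{q^s+q^{-s}}{(q-q^{-1})^2}$. For $1\le s\le p-1$, $1\le t\le s$ and $0\le n\le s-1$ put $v^\alpha(s,t)=\sum_{\ell=0}^{2p-1}(\alpha q^{-(s-2t+1)})^\ell K^\ell$, $a_n^\alpha(s,t)=F^nE^{p-1}F^{p-t}v^\alpha(s,t)$, $\mu_m^\alpha(s)=\prod_{j=p-s-(m-1)}^{p-s-1}(-\alpha[j][p-s-j])$, $b_n^\alpha(s,t)=F^n\sum_{m=1}^{p-s}\mu_m^\alpha(s)E^{p-m-1}F^{p-t-m}v^\alpha(s,t)$,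 and $$\gamma^{\alpha}(s)=2p\prod_{m=1}^{p-s-1}(-\alpha[m][p-s-m])\prod_{i=1}^{s-1}(\alpha[i][s-i]),$$ $$\delta^{\alpha}(s)=2p\prod_{m=1}^{p-s-1}(-\alpha[m][p-s-m])\sum_{j=1}^{s-1}\prod_{\substack{1\le k\le s-1\\k\ne j}}(\alpha[k][s-k])+2p\prod_{i=1}^{s-1}(\alpha[i][s-i])\sum_{n=1}^{p-s-1}\prod_{\substack{1\le k\le p-s-1\\k\ne n}}(-\alpha[k][p-s-k]).$$ Then $$e^{\alpha}(s,t)=\frac{1}{\gamma^{\alpha}(s)}\Big(b_{t-1}^{\alpha}(s,t)-\frac{\delta^{\alpha}(s)}{\gamma^{\alpha}(s)}a_{t-1}^{\alpha}(s,t)\Big).$$ *)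

theory Defs
  imports Complex_Main "HOL-Library.Cardinality"
begin

section \<open>The restricted quantum group of $sl_2$\<close>

definition qroot :: "nat \<Rightarrow> complex" where
  "qroot p = exp (of_real pi * \<i> / of_nat p)"

definition qnum :: "nat \<Rightarrow> nat \<Rightarrow> complex" where
  "qnum p n = (qroot p ^ n - inverse (qroot p) ^ n) / (qroot p - inverse (qroot p))"

text \<open>
  The algebra is constructed from its presentation: formal expressions in the generators
  (with complex scalars) modulo the least congruence that contains the axioms of associative
  unital complex algebras and the defining relations.  The scalar \<open>c\<close> is the expression
  \<open>TScal c\<close>, which stands for \<open>c\<close> times the unit.
\<close>

datatype uq_term =
    TE | TF | TK | TKinv
  | TScal complex
  | TAdd uq_term uq_term
  | TMul uq_term uq_term

primrec TPow :: "uq_term \<Rightarrow> nat \<Rightarrow> uq_term" where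
  "TPow x 0 = TScal 1"
| "TPow x (Suc n) = TMul x (TPow x n)"

abbreviation TDiff :: "uq_term \<Rightarrow> uq_term \<Rightarrow> uq_term" where
  "TDiff x y \<equiv> TAdd x (TMul (TScal (- 1)) y)"

inductive uq_eq :: "nat \<Rightarrow> uq_term \<Rightarrow> uq_term \<Rightarrow> bool" for p :: nat where
  refl: "uq_eq p x x"
| sym: "uq_eq p x y \<Longrightarrow> uq_eq p y x"
| trans: "uq_eq p x y \<Longrightarrow> uq_eq p y z \<Longrightarrow> uq_eq p x z"
| cong_add: "uq_eq p x x' \<Longrightarrow> uq_eq p y y' \<Longrightarrow> uq_eq p (TAdd x y) (TAdd x' y')"
| cong_mul: "uq_eq p x x' \<Longrightarrow> uq_eq p y y' \<Longrightarrow> uq_eq p (TMul x y) (TMul x' y')"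
  \<comment> \<open>associative unital complex algebras\<close>
| add_assoc: "uq_eq p (TAdd (TAdd x y) z) (TAdd x (TAdd y z))"
| add_comm: "uq_eq p (TAdd x y) (TAdd y x)"
| add_zero: "uq_eq p (TAdd (TScal 0) x) x"
| add_inv: "uq_eq p (TDiff x x) (TScal 0)"
| mul_assoc: "uq_eq p (TMul (TMul x y) z) (TMul x (TMul y z))"
| mul_one_left: "uq_eq p (TMul (TScal 1) x) x"
| mul_one_right: "uq_eq p (TMul x (TScal 1)) x"
| distrib_left: "uq_eq p (TMul x (TAdd y z)) (TAdd (TMul x y) (TMul x z))"
| distrib_right: "uq_eq p (TMul (TAdd x y) z) (TAdd (TMul x z) (TMul y z))"
| scal_add: "uq_eq p (TScal (c + d)) (TAdd (TScal c) (TScal d))"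
| scal_mul: "uq_eq p (TScal (c * d)) (TMul (TScal c) (TScal d))"
| scal_central: "uq_eq p (TMul (TScal c) x) (TMul x (TScal c))"
  \<comment> \<open>defining relations\<close>
| rel_K_Kinv: "uq_eq p (TMul TK TKinv) (TScal 1)"
| rel_Kinv_K: "uq_eq p (TMul TKinv TK) (TScal 1)"
| rel_KE: "uq_eq p (TMul (TMul TK TE) TKinv) (TMul (TScal (qroot p ^ 2)) TE)"
| rel_KF: "uq_eq p (TMul (TMul TK TF) TKinv) (TMul (TScal (inverse (qroot p) ^ 2)) TF)"
| rel_EF: "uq_eq p (TDiff (TMul TE TF) (TMul TF TE))
    (TMul (TScal (1 / (qroot p - inverse (qroot p)))) (TDiff TK TKinv))"
| rel_E_pow: "uq_eq p (TPow TE p) (TScal 0)"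
| rel_F_pow: "uq_eq p (TPow TF p) (TScal 0)"
| rel_K_pow: "uq_eq p (TPow TK (2 * p)) (TScal 1)"

lemma equivp_uq_eq: "equivp (uq_eq p)"
  by (intro equivpI reflpI sympI transpI) (auto intro: uq_eq.refl uq_eq.sym uq_eq.trans)

text \<open>
  The parameter \<open>p\<close> enters as the cardinality of the index type \<open>'p\<close>, so that the algebra is
  a type and the ring type classes apply to it.
\<close>

quotient_type 'p uq = uq_term / "uq_eq CARD('p)"
  by (rule equivp_uq_eq)

lift_definition scal :: "complex \<Rightarrow> 'p uq" is TScal .
lift_definition gE :: "'p uq" is TE .
lift_definition gF :: "'p uq" is TF .
lift_definition gK :: "'p uq" is TK .
lift_definition gKinv :: "'p uq" is TKinv .

text \<open>The counit, which shows that the algebra is not the zero ring.\<close>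

primrec counit_term :: "uq_term \<Rightarrow> complex" where
  "counit_term TE = 0"
| "counit_term TF = 0"
| "counit_term TK = 1"
| "counit_term TKinv = 1"
| "counit_term (TScal c) = c"
| "counit_term (TAdd x y) = counit_term x + counit_term y"
| "counit_term (TMul x y) = counit_term x * counit_term y"

lemma counit_term_TPow: "counit_term (TPow x n) = counit_term x ^ n"
  by (induction n) auto

lemma counit_term_cong: "uq_eq p x y \<Longrightarrow> p > 0 \<Longrightarrow> counit_term x = counit_term y"
  by (induction rule: uq_eq.induct)
    (auto simp: counit_term_TPow algebra_simps)

instantiation uq :: (type) ring
begin

lift_definition zero_uq :: "'a uq" is "TScal 0" .
lift_definition plus_uq :: "'a uq \<Rightarrow> 'a uq \<Rightarrow> 'a uq" is TAdd by (rule uq_eq.cong_add)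
lift_definition times_uq :: "'a uq \<Rightarrow> 'a uq \<Rightarrow> 'a uq" is TMul by (rule uq_eq.cong_mul)
lift_definition uminus_uq :: "'a uq \<Rightarrow> 'a uq" is "TMul (TScal (- 1))"
  by (intro uq_eq.cong_mul uq_eq.refl)
lift_definition minus_uq :: "'a uq \<Rightarrow> 'a uq \<Rightarrow> 'a uq" is TDiff
  by (intro uq_eq.cong_add uq_eq.cong_mul uq_eq.refl)

instance
proof
  fix a b c :: "'a uq"
  show "a + b + c = a + (b + c)" by transfer (rule uq_eq.add_assoc)
  show "a + b = b + a" by transfer (rule uq_eq.add_comm)
  show "0 + a = a" by transfer (rule uq_eq.add_zero)
  show "- a + a = 0"
    by transfer (blast intro: uq_eq.trans uq_eq.add_comm uq_eq.add_inv)
  show "a - b = a + - b" by transfer (rule uq_eq.refl)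
  show "a * b * c = a * (b * c)" by transfer (rule uq_eq.mul_assoc)
  show "(a + b) * c = a * c + b * c" by transfer (rule uq_eq.distrib_right)
  show "a * (b + c) = a * b + a * c" by transfer (rule uq_eq.distrib_left)
qed

end

instantiation uq :: (finite) ring_1
begin

lift_definition one_uq :: "'a uq" is "TScal 1" .

instance
proof
  fix a :: "'a uq"
  show "1 * a = a" by transfer (rule uq_eq.mul_one_left)
  show "a * 1 = a" by transfer (rule uq_eq.mul_one_right)
  show "(0 :: 'a uq) \<noteq> 1"
    by transfer (use counit_term_cong zero_less_card_finite in force)
qed

end

lemma scal_simps [simp]:
  shows scal_0: "(scal 0 :: 'p uq) = 0"
    and scal_1: "(scal 1 :: 'q::finite uq) = 1"
  by (transfer, rule uq_eq.refl)+

lemma scal_add: "scal (c + d) = (scal c + scal d :: 'p uq)"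
  by transfer (rule uq_eq.scal_add)

lemma scal_mult: "scal (c * d) = (scal c * scal d :: 'p uq)"
  by transfer (rule uq_eq.scal_mul)

lemma scal_commute: "scal c * x = x * scal c"
  by transfer (rule uq_eq.scal_central)

lemma abs_uq_TPow: "(abs_uq (TPow t n) :: 'p::finite uq) = abs_uq t ^ n"
  by (induction n) (simp_all add: one_uq.abs_eq times_uq.abs_eq [symmetric])

lemma uq_relations:
  defines "q \<equiv> qroot CARD('p::finite)"
  shows "(gK :: 'p uq) * gKinv = 1"
    and "(gKinv :: 'p uq) * gK = 1"
    and "(gK :: 'p uq) * gE * gKinv = scal (q ^ 2) * gE"
    and "(gK :: 'p uq) * gF * gKinv = scal (inverse q ^ 2) * gF"
    and "(gE :: 'p uq) * gF - gF * gE = scal (1 / (q - inverse q)) * (gK - gKinv)"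
    and "(gE :: 'p uq) ^ CARD('p) = 0"
    and "(gF :: 'p uq) ^ CARD('p) = 0"
    and "(gK :: 'p uq) ^ (2 * CARD('p)) = 1"
proof -
  show "(gK :: 'p uq) * gKinv = 1" by transfer (rule uq_eq.rel_K_Kinv)
  show "(gKinv :: 'p uq) * gK = 1" by transfer (rule uq_eq.rel_Kinv_K)
  show "(gK :: 'p uq) * gE * gKinv = scal (q ^ 2) * gE"
    unfolding q_def by transfer (rule uq_eq.rel_KE)
  show "(gK :: 'p uq) * gF * gKinv = scal (inverse q ^ 2) * gF"
    unfolding q_def by transfer (rule uq_eq.rel_KF)
  show "(gE :: 'p uq) * gF - gF * gE = scal (1 / (q - inverse q)) * (gK - gKinv)"
    unfolding q_def by transfer (rule uq_eq.rel_EF)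
  have "(abs_uq (TPow TE CARD('p)) :: 'p uq) = abs_uq (TScal 0)"
    by (simp add: uq.abs_eq_iff uq_eq.rel_E_pow)
  then show "(gE :: 'p uq) ^ CARD('p) = 0"
    by (simp add: abs_uq_TPow gE_def zero_uq_def)
  have "(abs_uq (TPow TF CARD('p)) :: 'p uq) = abs_uq (TScal 0)"
    by (simp add: uq.abs_eq_iff uq_eq.rel_F_pow)
  then show "(gF :: 'p uq) ^ CARD('p) = 0"
    by (simp add: abs_uq_TPow gF_def zero_uq_def)
  have "(abs_uq (TPow TK (2 * CARD('p))) :: 'p uq) = abs_uq (TScal 1)"
    by (simp only: uq.abs_eq_iff uq_eq.rel_K_pow)
  then show "(gK :: 'p uq) ^ (2 * CARD('p)) = 1"
    by (simp add: abs_uq_TPow gK_def one_uq_def)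
qed

text \<open>
  The universal property: \<open>\<iota>\<close> is the structure map of a complex algebra \<open>'b\<close>, and every choice
  of elements of \<open>'b\<close> that satisfy the defining relations extends to a unique homomorphism.
\<close>

primrec eval_term ::
  "(complex \<Rightarrow> 'b) \<Rightarrow> 'b \<Rightarrow> 'b \<Rightarrow> 'b \<Rightarrow> 'b \<Rightarrow> uq_term \<Rightarrow> 'b::ring_1" where
  "eval_term i e f k k' TE = e"
| "eval_term i e f k k' TF = f"
| "eval_term i e f k k' TK = k"
| "eval_term i e f k k' TKinv = k'"
| "eval_term i e f k k' (TScal c) = i c"
| "eval_term i e f k k' (TAdd x y) = eval_term i e f k k' x + eval_term i e f k k' y"
| "eval_term i e f k k' (TMul x y) = eval_term i e f k k' x * eval_term i e f k k' y"

lemma uq_universal: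
  fixes \<iota> :: "complex \<Rightarrow> 'b::ring_1" and e f k k' :: 'b
  defines "q \<equiv> qroot CARD('p::finite)"
  assumes \<iota>: "\<iota> 1 = 1" "\<And>c d. \<iota> (c + d) = \<iota> c + \<iota> d" "\<And>c d. \<iota> (c * d) = \<iota> c * \<iota> d"
      "\<And>c x. \<iota> c * x = x * \<iota> c"
    and rels: "k * k' = 1" "k' * k = 1"
      "k * e * k' = \<iota> (q ^ 2) * e"
      "k * f * k' = \<iota> (inverse q ^ 2) * f"
      "e * f - f * e = \<iota> (1 / (q - inverse q)) * (k - k')"
      "e ^ CARD('p) = 0" "f ^ CARD('p) = 0" "k ^ (2 * CARD('p)) = 1"
  shows "\<exists>!\<phi> :: 'p uq \<Rightarrow> 'b.
    (\<forall>x y. \<phi> (x + y) = \<phi> x + \<phi> y) \<and> (\<forall>x y. \<phi> (x * y) = \<phi> x * \<phi> y) \<and>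
    (\<forall>c. \<phi> (scal c) = \<iota> c) \<and> \<phi> gE = e \<and> \<phi> gF = f \<and> \<phi> gK = k \<and> \<phi> gKinv = k'"
    (is "\<exists>!\<phi>. ?P \<phi>")
proof -
  let ?ev = "eval_term \<iota> e f k k'"
  have \<iota>0: "\<iota> 0 = 0" using \<iota>(2)[of 0 0] by simp
  have \<iota>m: "\<iota> (- 1) = - 1" using \<iota>(1) \<iota>(2)[of "- 1" 1] \<iota>0 by (simp add: eq_neg_iff_add_eq_0)
  have pow: "?ev (TPow x n) = ?ev x ^ n" for x n by (induction n) (simp_all add: \<iota>(1))
  have cong: "?ev x = ?ev y" if "uq_eq CARD('p) x y" for x y
    using that
  proof (induction rule: uq_eq.induct)
    case (scal_central c x)
    then show ?case by (simp add: \<iota>(4))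
  next
    case rel_EF
    then show ?case using rels(5) by (simp add: \<iota>m q_def)
  qed (use rels in \<open>simp_all add: pow \<iota>(1-3) \<iota>0 \<iota>m algebra_simps q_def\<close>)
  define \<phi> where "\<phi> x = ?ev (rep_uq x)" for x :: "'p uq"
  have abs: "\<phi> (abs_uq t) = ?ev t" for t
    unfolding \<phi>_def by (rule cong) (rule rep_abs_rsp_left [OF Quotient3_uq], rule uq_eq.refl)
  show ?thesis
  proof
    show "?P \<phi>"
    proof (intro conjI allI)
      fix x y :: "'p uq"
      obtain s t where st: "x = abs_uq s" "y = abs_uq t"
        by (metis Quotient3_abs_rep [OF Quotient3_uq])
      show "\<phi> (x + y) = \<phi> x + \<phi> y" "\<phi> (x * y) = \<phi> x * \<phi> y"
        by (simp_all add: st plus_uq.abs_eq times_uq.abs_eq abs)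
    qed (simp_all add: scal.abs_eq gE_def gF_def gK_def gKinv_def abs)
  next
    fix \<psi> :: "'p uq \<Rightarrow> 'b"
    assume \<psi>: "?P \<psi>"
    have "\<psi> (abs_uq t) = ?ev t" for t
      by (induction t)
        (use \<psi> in \<open>simp_all add: scal.abs_eq gE_def gF_def gK_def gKinv_def
          flip: plus_uq.abs_eq times_uq.abs_eq\<close>)
    then show "\<psi> = \<phi>"
      by (metis abs Quotient3_abs_rep [OF Quotient3_uq] ext)
  qed
qed

section \<open>The blocks and the primitive idempotents\<close>

definition casimir :: "'p::finite uq" where
  "casimir = (let q = qroot CARD('p) in
    gE * gF + scal (1 / (q - inverse q) ^ 2) * (scal (inverse q) * gK + scal q * gKinv))"

definition casimir_eigenvalue :: "nat \<Rightarrow> nat \<Rightarrow> complex" where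
  "casimir_eigenvalue p s =
    (qroot p ^ s + inverse (qroot p) ^ s) / (qroot p - inverse (qroot p)) ^ 2"

definition block :: "nat \<Rightarrow> 'p::finite uq set" where
  "block s = {x. \<exists>n. (casimir - scal (casimir_eigenvalue CARD('p) s)) ^ n * x = 0}"

text \<open>
  A subset \<open>A\<close> closed under the ring operations may have a unit different from that of the
  ambient ring; the notion below does not refer to a unit.
\<close>

definition primitive_idempotent_in :: "'a::ring set \<Rightarrow> 'a \<Rightarrow> bool" where
  "primitive_idempotent_in A e \<longleftrightarrow>
    e \<in> A \<and> e \<noteq> 0 \<and> e * e = e \<and>
    \<not> (\<exists>f\<in>A. \<exists>g\<in>A. f \<noteq> 0 \<and> g \<noteq> 0 \<and> f * f = f \<and> g * g = g \<and>
         f * g = 0 \<and> g * f = 0 \<and> e = f + g)"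

text \<open>
  The sign \<open>\<alpha>\<close> is a complex number, meant to be \<open>1\<close> or \<open>- 1\<close>.  Subtractions of natural numbers
  below are not truncated for \<open>1 \<le> s \<le> p - 1\<close> and \<open>1 \<le> t \<le> s\<close>.
\<close>

definition vv :: "complex \<Rightarrow> nat \<Rightarrow> nat \<Rightarrow> 'p::finite uq" where
  "vv \<alpha> s t = (\<Sum>l<2 * CARD('p).
    scal ((\<alpha> * qroot CARD('p) powi (- (int s - 2 * int t + 1))) ^ l) * gK ^ l)"

definition aa :: "complex \<Rightarrow> nat \<Rightarrow> nat \<Rightarrow> nat \<Rightarrow> 'p::finite uq" where
  "aa \<alpha> n s t = gF ^ n * gE ^ (CARD('p) - 1) * gF ^ (CARD('p) - t) * vv \<alpha> s t"

definition mu :: "nat \<Rightarrow> complex \<Rightarrow> nat \<Rightarrow> nat \<Rightarrow> complex" where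
  "mu p \<alpha> m s = (\<Prod>j = p - s - (m - 1)..p - s - 1. - \<alpha> * qnum p j * qnum p (p - s - j))"

definition bb :: "complex \<Rightarrow> nat \<Rightarrow> nat \<Rightarrow> nat \<Rightarrow> 'p::finite uq" where
  "bb \<alpha> n s t = gF ^ n * (\<Sum>m = 1..CARD('p) - s.
    scal (mu CARD('p) \<alpha> m s) * gE ^ (CARD('p) - m - 1) * gF ^ (CARD('p) - t - m) * vv \<alpha> s t)"

definition gam :: "nat \<Rightarrow> complex \<Rightarrow> nat \<Rightarrow> complex" where
  "gam p \<alpha> s = 2 * of_nat p *
    (\<Prod>m = 1..p - s - 1. - \<alpha> * qnum p m * qnum p (p - s - m)) *
    (\<Prod>i = 1..s - 1. \<alpha> * qnum p i * qnum p (s - i))"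

definition del :: "nat \<Rightarrow> complex \<Rightarrow> nat \<Rightarrow> complex" where
  "del p \<alpha> s =
    2 * of_nat p * (\<Prod>m = 1..p - s - 1. - \<alpha> * qnum p m * qnum p (p - s - m)) *
      (\<Sum>j = 1..s - 1. \<Prod>k \<in> {1..s - 1} - {j}. \<alpha> * qnum p k * qnum p (s - k)) +
    2 * of_nat p * (\<Prod>i = 1..s - 1. \<alpha> * qnum p i * qnum p (s - i)) *
      (\<Sum>n = 1..p - s - 1. \<Prod>k \<in> {1..p - s - 1} - {n}. - \<alpha> * qnum p k * qnum p (p - s - k))"

definition ee :: "complex \<Rightarrow> nat \<Rightarrow> nat \<Rightarrow> 'p::finite uq" where
  "ee \<alpha> s t = (let \<gamma> = gam CARD('p) \<alpha> s; \<delta> = del CARD('p) \<alpha> s in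
    scal (1 / \<gamma>) * (bb \<alpha> (t - 1) s t - scal (\<delta> / \<gamma>) * aa \<alpha> (t - 1) s t))"

end

theory Submission
  imports Defs "HOL-Computational_Algebra.Polynomial"
begin

text \<open>
  Let \<open>v = v\<^sup>\<alpha>(s,t)\<close>, which is \<open>2p\<close> times the projection to a weight space of \<open>K\<close>, and let \<open>N\<close> be
  the Casimir element minus its eigenvalue on \<open>Q\<^sub>s\<close>.  Between weight vectors, \<open>EF\<close> and \<open>FE\<close> act as \<open>N\<close>
  plus a scalar, so \<open>F\<^sup>i E\<^sup>i\<^sup>+\<^sup>k F\<^sup>k v\<close> is a product of such linear factors times \<open>v\<close>.  With
  \<open>H(X) = \<Prod>(X + \<alpha>[j][s-j]) \<Prod>(X - \<alpha>[i][p-s-i])\<close> this gives \<open>a = N H(N) v\<close> and \<open>N\<^sup>2 H(N) v = 0\<close>, while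
  the sum defining \<open>b\<close> telescopes to \<open>H(N) v\<close>.  Since \<open>\<gamma> = 2p H(0)\<close> and \<open>\<delta> = 2p H'(0)\<close>, the
  element \<open>e\<close> is \<open>G(N) v / 2p\<close> with \<open>H dvd G\<close> and \<open>G \<equiv> 1\<close> modulo \<open>X\<^sup>2\<close>; hence \<open>G\<^sup>2 - G\<close> annihilates \<open>v\<close>
  and \<open>e\<close> is idempotent with \<open>N\<^sup>2 e = 0\<close>.

  The elements are orthogonal because their weights are distinct, and nonzero because \<open>e\<close> fixes a
  weight vector of the simple module of dimension \<open>s\<close>.  As the algebra times \<open>e\<close> is spanned by the \<open>E\<^sup>i y\<close> and
  \<open>F\<^sup>i y\<close> with \<open>y\<close> in the span of \<open>e\<close> and \<open>N e\<close>, comparing weights shows that the corner of \<open>e\<close> is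
  that span, a local ring; so \<open>e\<close> is primitive.
\<close>

section \<open>Powers of the root of unity\<close>

lemma qroot_power: "qroot p ^ n = cis (pi * real n / real p)"
proof -
  have "qroot p = cis (pi / real p)"
    by (simp add: qroot_def cis_conv_exp mult.commute)
  then show ?thesis by (simp add: Complex.DeMoivre mult.commute)
qed

lemma qroot_neq_0 [simp]: "qroot p \<noteq> 0"
  by (simp add: qroot_def)

lemma qroot_power_self: "p > 0 \<Longrightarrow> qroot p ^ p = - 1"
  by (simp add: qroot_power)

lemma qroot_power_2p: "p > 0 \<Longrightarrow> qroot p ^ (2 * p) = 1"
  by (simp add: power_mult mult.commute [of 2] qroot_power_self)

text \<open>\<open>q\<close> has exact order \<open>2p\<close>: equality would make
  \<open>2 pi k / p\<close> a multiple of \<open>2 pi\<close>, hence \<open>p\<close> a divisor of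
  \<open>k\<close>.\<close>

lemma qroot_power_neq_1:
  assumes "0 < k" "k < p"
  shows "qroot p ^ (2 * k) \<noteq> 1"
proof
  assume "qroot p ^ (2 * k) = 1"
  then have "cos (pi * real (2 * k) / real p) = 1"
    unfolding qroot_power by (metis cis.sel(1) one_complex.sel(1))
  then obtain n :: int where "pi * real (2 * k) / real p = of_int n * 2 * pi"
    unfolding cos_one_2pi_int by blast
  then have "real k = of_int n * real p"
    using assms by (simp add: field_simps)
  then have "int k = n * int p"
    by (metis of_int_eq_iff of_int_mult of_int_of_nat_eq)
  then have "int p dvd int k" by simp
  then show False using assms by (simp add: nat_dvd_not_less)
qed

lemma qroot_power_diff_neq_0:
  assumes "0 < k" "k < p"
  shows "qroot p ^ k - inverse (qroot p) ^ k \<noteq> 0"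
proof
  assume "qroot p ^ k - inverse (qroot p) ^ k = 0"
  then have "qroot p ^ k * qroot p ^ k = 1"
    by (metis eq_iff_diff_eq_0 left_inverse power_inverse power_not_zero qroot_neq_0)
  then show False
    using qroot_power_neq_1 [OF assms] by (simp add: mult_2 power_add)
qed

lemma qroot_diff_neq_0: "2 \<le> p \<Longrightarrow> qroot p - inverse (qroot p) \<noteq> 0"
  using qroot_power_diff_neq_0 [of 1 p] by simp

lemma qnum_neq_0: "0 < k \<Longrightarrow> k < p \<Longrightarrow> qnum p k \<noteq> 0"
  using qroot_power_diff_neq_0 [of k p] qroot_power_diff_neq_0 [of 1 p] by (simp add: qnum_def)

section \<open>Weights and the scalars of the Casimir element\<close>

text \<open>For \<open>j\<close> from \<open>1\<close> to \<open>s\<close> these are the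
  \<open>K\<close>-eigenvalues of the simple module of dimension \<open>s\<close> and sign \<alpha>,
  highest first; \<open>F\<close> raises \<open>j\<close> by one. Integer exponents let
  \<open>j\<close> run past \<open>s\<close>.\<close>

definition wt :: "nat \<Rightarrow> complex \<Rightarrow> nat \<Rightarrow> nat \<Rightarrow> complex" where
  "wt p \<alpha> s j = \<alpha> * qroot p powi (int s - 2 * int j + 1)"

text \<open>The scalar in \<open>EF = N + const\<close> on weight \<open>wt p \<alpha> s j\<close>; it equals \<open>\<alpha>[j][s-j]\<close> with \<open>[-n] = -[n]\<close>.\<close>

definition cas_shift :: "nat \<Rightarrow> complex \<Rightarrow> nat \<Rightarrow> nat \<Rightarrow> complex" where
  "cas_shift p \<alpha> s j = \<alpha> * (qroot p powi int s + qroot p powi (- int s)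
     - qroot p powi (int s - 2 * int j) - qroot p powi (2 * int j - int s))
     / (qroot p - inverse (qroot p)) ^ 2"

lemma wt_neq_0: "\<alpha> * \<alpha> = 1 \<Longrightarrow> wt p \<alpha> s j \<noteq> 0"
  by (auto simp: wt_def)

text \<open>The scalars in \<open>vv\<close> are powers of this value, so \<open>vv\<close> sums the
  powers of \<open>K\<close> divided by its weight.\<close>

lemma inverse_wt:
  assumes "\<alpha> * \<alpha> = 1"
  shows "inverse (wt p \<alpha> s j) = \<alpha> * qroot p powi (- (int s - 2 * int j + 1))"
  using inverse_unique [OF assms] by (simp only: wt_def inverse_mult_distrib power_int_minus)

lemma wt_Suc: "wt p \<alpha> s (Suc j) = inverse (qroot p) ^ 2 * wt p \<alpha> s j"
proof -
  have "int s - 2 * int (Suc j) + 1 = - 2 + (int s - 2 * int j + 1)" by simp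
  then have "qroot p powi (int s - 2 * int (Suc j) + 1) =
      qroot p powi (- 2) * qroot p powi (int s - 2 * int j + 1)"
    by (metis power_int_add qroot_neq_0)
  then show ?thesis by (simp add: wt_def power_int_minus power_inverse)
qed

lemma wt_power_2p:
  assumes "\<alpha> * \<alpha> = 1" "p > 0"
  shows "wt p \<alpha> s j ^ (2 * p) = 1"
proof -
  have "(qroot p powi n) ^ (2 * p) = 1" for n
    by (metis assms(2) mult.commute power_int_mult power_int_of_nat qroot_power_2p power_int_1_left)
  moreover have "\<alpha> ^ (2 * p) = 1"
    using assms(1) by (simp add: power_mult power2_eq_square)
  ultimately show ?thesis by (simp add: wt_def power_mult_distrib)
qed

text \<open>Each index step costs a factor \<open>q^2\<close>, so equal weights would give
  \<open>q^(2(j - i)) = 1\<close>.\<close>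

lemma wt_neq:
  assumes "\<alpha> * \<alpha> = 1" "i < j" "j < i + p"
  shows "wt p \<alpha> s i \<noteq> wt p \<alpha> s j"
proof
  have *: "wt p \<alpha> s (i + k) * qroot p ^ (2 * k) = wt p \<alpha> s i" for k
    by (induction k) (simp_all add: wt_Suc field_simps power2_eq_square)
  assume "wt p \<alpha> s i = wt p \<alpha> s j"
  then have "qroot p ^ (2 * (j - i)) = 1"
    using *[of "j - i"] assms wt_neq_0 [OF assms(1), of p s j] by simp
  then show False using qroot_power_neq_1 [of "j - i" p] assms by simp
qed

text \<open>\<open>q^p = -1\<close> absorbs the sign. The weights for sign \<open>-1\<close> and
  \<open>p - s\<close> thus continue the list of those for sign \<open>1\<close> and
  \<open>s\<close>.\<close>

lemma wt_flip:
  assumes "s \<le> p" "p > 0"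
  shows "wt p (- 1) (p - s) u = wt p 1 s (s + u)"
proof -
  have "int (p - s) - 2 * int u + 1 = int p + (int s - 2 * int (s + u) + 1)"
    using assms by simp
  then have "qroot p powi (int (p - s) - 2 * int u + 1) =
      qroot p powi int p * qroot p powi (int s - 2 * int (s + u) + 1)"
    by (metis power_int_add qroot_neq_0)
  then show ?thesis
    using assms by (simp add: wt_def qroot_power_self)
qed

text \<open>From \<open>q^(p - s) = - q^(-s)\<close>; it puts the elements of sign \<open>-1\<close>
  and index \<open>p - s\<close> into the block of \<open>s\<close>.\<close>

lemma casimir_eigenvalue_flip:
  assumes "s \<le> p" "p > 0"
  shows "- casimir_eigenvalue p (p - s) = casimir_eigenvalue p s"
proof -
  have "qroot p ^ (p - s) * qroot p ^ s = - 1"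
    using assms by (simp add: qroot_power_self flip: power_add)
  then have "qroot p ^ (p - s) = - inverse (qroot p ^ s)"
    by (simp add: field_simps)
  then show ?thesis
    by (simp add: casimir_eigenvalue_def power_inverse add.commute minus_divide_left)
qed

lemma cas_shift_0 [simp]: "cas_shift p \<alpha> s 0 = 0"
  and cas_shift_self [simp]: "cas_shift p \<alpha> s s = 0"
  by (simp_all add: cas_shift_def)

text \<open>With \<open>k = s - j\<close> the numerator factors as
  \<open>(q^j - q^(-j)) (q^k - q^(-k))\<close>.\<close>

lemma cas_shift_low:
  assumes "j \<le> s"
  shows "cas_shift p \<alpha> s j = \<alpha> * qnum p j * qnum p (s - j)"
proof -
  obtain k where k: "s = j + k" using assms le_Suc_ex by blast
  have e: "int s - 2 * int j = int k - int j" "2 * int j - int s = int j - int k"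
    by (simp_all add: k)
  define q where "q = qroot p"
  have "q powi int s + q powi (- int s) - q powi (int s - 2 * int j) - q powi (2 * int j - int s)
      = (q ^ j - inverse q ^ j) * (q ^ k - inverse q ^ k)"
    unfolding e by (simp add: k q_def power_int_diff power_int_minus power_int_add power_inverse
        power_add divide_inverse algebra_simps)
  then show ?thesis
    by (simp add: cas_shift_def qnum_def k power2_eq_square flip: q_def)
qed

text \<open>With \<open>k = p - s - i\<close>, the relation \<open>q^(s + i + k) = -1\<close> turns
  \<open>q^k\<close> into \<open>- q^(-s-i)\<close>, so the numerator factors again, with the
  opposite sign.\<close>

lemma cas_shift_high:
  assumes "i \<le> p - s" "s \<le> p" "p > 0"
  shows "cas_shift p \<alpha> s (s + i) = - \<alpha> * qnum p i * qnum p (p - s - i)"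
proof -
  obtain k where k: "p = s + i + k" using assms
    by (metis le_add_diff_inverse le_Suc_ex add.assoc)
  define q where "q = qroot p"
  have "q ^ s * q ^ i * q ^ k = - 1"
    unfolding q_def using qroot_power_self [OF assms(3)] k by (metis power_add)
  then have k': "q ^ k = - (inverse q ^ s * inverse q ^ i)"
    by (simp add: q_def power_inverse field_simps)
  then have k'': "inverse q ^ k = - (q ^ s * q ^ i)"
    by (simp add: power_inverse)
  have e: "int s - 2 * int (s + i) = - int s - int i - int i"
     "2 * int (s + i) - int s = int s + (int i + int i)" "p - s - i = k"
    using k by simp_all
  have "q powi int s + q powi (- int s) - q powi (int s - 2 * int (s + i)) - q powi (2 * int (s + i) - int s)
      = - ((q ^ i - inverse q ^ i) * (q ^ k - inverse q ^ k))"
  proof -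
    have "q powi (- int s - int i - int i) = inverse q ^ s * inverse q ^ i * inverse q ^ i"
      by (simp only: power_int_diff qroot_neq_0 q_def disj_not1 simp_thms power_int_minus
          power_int_of_nat power_inverse divide_inverse)
    moreover have "q powi (int s + (int i + int i)) = q ^ s * q ^ i * q ^ i"
      by (simp only: power_int_add qroot_neq_0 q_def simp_thms power_int_of_nat mult.assoc)
    moreover have cancel: "q ^ i * (z * inverse (q ^ i)) = z" "q ^ i * (inverse (q ^ i) * z) = z" for z
      by (simp_all add: q_def)
    ultimately show ?thesis
      unfolding e k' k'' by (simp add: cancel power_int_minus power_inverse algebra_simps)
  qed
  then show ?thesis
    unfolding cas_shift_def qnum_def e(3) q_def [symmetric] by (simp add: power2_eq_square)
qed

text \<open>The subtracted part is the value of the \<open>K\<close>-terms of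
  \<open>C = EF + ...\<close> on weight index \<open>j\<close>; the shift is what remains for
  \<open>EF\<close>.\<close>

lemma cas_shift_wt:
  assumes "\<alpha> * \<alpha> = 1"
  shows "cas_shift p \<alpha> s j = \<alpha> * casimir_eigenvalue p s -
    (inverse (qroot p) / (qroot p - inverse (qroot p)) ^ 2 * wt p \<alpha> s j +
     qroot p / (qroot p - inverse (qroot p)) ^ 2 * inverse (wt p \<alpha> s j))"
proof -
  have "int s - 2 * int j = - 1 + (int s - 2 * int j + 1)"
    and "2 * int j - int s = 1 + (- (int s - 2 * int j + 1))" by simp_all
  then have e: "qroot p powi (int s - 2 * int j) = inverse (qroot p) * qroot p powi (int s - 2 * int j + 1)"
    "qroot p powi (2 * int j - int s) = qroot p * qroot p powi (- (int s - 2 * int j + 1))"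
    by (metis power_int_add qroot_neq_0 power_int_minus power_int_1_right)+
  define w where "w = qroot p powi (int s - 2 * int j + 1)"
  have w: "wt p \<alpha> s j = \<alpha> * w" "inverse (wt p \<alpha> s j) = \<alpha> * inverse w"
    using inverse_wt [OF assms, of p s j] by (simp_all only: wt_def w_def power_int_minus)
  show ?thesis
    unfolding cas_shift_def casimir_eigenvalue_def w e power_int_minus w_def [symmetric]
    using inverse_unique [OF assms]
    by (simp add: power_inverse diff_divide_distrib add_divide_distrib algebra_simps)
qed

text \<open>The \<open>K\<close>-terms of \<open>C = FE + ...\<close> take at index
  \<open>j + 1\<close> the value that those of the \<open>EF\<close> form take at index
  \<open>j\<close>.\<close>

lemma cas_shift_wt_Suc:
  assumes "\<alpha> * \<alpha> = 1"
  shows "cas_shift p \<alpha> s j = \<alpha> * casimir_eigenvalue p s -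
    (qroot p / (qroot p - inverse (qroot p)) ^ 2 * wt p \<alpha> s (Suc j) +
     inverse (qroot p) / (qroot p - inverse (qroot p)) ^ 2 * inverse (wt p \<alpha> s (Suc j)))"
proof -
  have "qroot p * wt p \<alpha> s (Suc j) = inverse (qroot p) * wt p \<alpha> s j"
    "inverse (qroot p) * inverse (wt p \<alpha> s (Suc j)) = qroot p * inverse (wt p \<alpha> s j)"
    by (simp_all add: wt_Suc power2_eq_square)
  then show ?thesis
    unfolding cas_shift_wt [OF assms(1)] times_divide_eq_left by simp
qed

text \<open>At index \<open>j + 1\<close>, \<open>EF\<close> has shift \<open>j + 1\<close> and
  \<open>FE\<close> has shift \<open>j\<close>, so this is the commutator relation; it is what the
  modules below have to satisfy.\<close>

lemma cas_shift_Suc_diff: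
  assumes "\<alpha> * \<alpha> = 1" "2 \<le> p"
  shows "cas_shift p \<alpha> s (Suc j) - cas_shift p \<alpha> s j =
    1 / (qroot p - inverse (qroot p)) * (wt p \<alpha> s (Suc j) - inverse (wt p \<alpha> s (Suc j)))"
proof -
  define d where "d = qroot p - inverse (qroot p)"
  have "d \<noteq> 0" using qroot_diff_neq_0 [OF assms(2)] by (simp add: d_def)
  then have "1 / d = d / d ^ 2" by (simp add: power2_eq_square)
  then have *: "1 / d * x = (qroot p / d ^ 2 - inverse (qroot p) / d ^ 2) * x" for x
    by (simp add: d_def diff_divide_distrib)
  show ?thesis
    unfolding cas_shift_wt_Suc [OF assms(1), of p s j] cas_shift_wt [OF assms(1), of p s "Suc j"]
      d_def [symmetric] *
    by (simp add: algebra_simps)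
qed

section \<open>Scalars, the Casimir element and weights\<close>

lemma scal_minus: "scal (- c) = - (scal c :: 'p uq)"
  by (metis scal_add scal_0 add.right_inverse add_eq_0_iff)

lemma scal_diff: "scal (c - d) = (scal c - scal d :: 'p uq)"
  by (metis scal_add scal_minus diff_conv_add_uminus)

lemma scal_mult_left: "scal c * (scal d * x) = (scal (c * d) * x :: 'p uq)"
  by (simp add: scal_mult mult.assoc)

lemma mult_scal_left: "x * (scal c * y) = scal c * (x * y :: 'p uq)"
  by (metis mult.assoc scal_commute)

lemmas scal_out = mult_scal_left [of gE] mult_scal_left [of gF]
  mult_scal_left [of gK] mult_scal_left [of gKinv]
  mult_scal_left [of "gE ^ i" for i] mult_scal_left [of "gF ^ i" for i]

lemma scal_of_nat: "scal (of_nat n) = (of_nat n :: 'p::finite uq)"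
  by (induction n) (simp_all add: scal_add)

lemma scal_mult_eq_0_iff: "scal c * x = 0 \<longleftrightarrow> c = 0 \<or> (x :: 'p::finite uq) = 0"
proof -
  have "x = 0" if "c \<noteq> 0" "scal c * x = 0"
  proof -
    have "x = scal (inverse c) * (scal c * x)" using that(1) by (simp add: scal_mult_left)
    then show ?thesis using that by simp
  qed
  then show ?thesis by auto
qed

lemma uq_induct:
  fixes x :: "'p::finite uq"
  assumes "P gE" "P gF" "P gK" "P gKinv" "\<And>c. P (scal c)"
    and "\<And>x y. P x \<Longrightarrow> P y \<Longrightarrow> P (x + y)" "\<And>x y. P x \<Longrightarrow> P y \<Longrightarrow> P (x * y)"
  shows "P x"
proof -
  have "P (abs_uq t)" for t
    by (induction t)
      (use assms in \<open>simp_all add: scal.abs_eq gE_def gF_def gK_def gKinv_def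
          flip: plus_uq.abs_eq times_uq.abs_eq\<close>)
  then show ?thesis
    by (metis Quotient3_abs_rep [OF Quotient3_uq])
qed

lemma gK_gE: "(gK :: 'p::finite uq) * gE = scal (qroot CARD('p) ^ 2) * (gE * gK)"
  by (metis mult.assoc mult.right_neutral uq_relations(2,3))

lemma gK_gF: "(gK :: 'p::finite uq) * gF = scal (inverse (qroot CARD('p)) ^ 2) * (gF * gK)"
  by (metis mult.assoc mult.right_neutral uq_relations(2,4))

lemma gE_gKinv: "(gE :: 'p::finite uq) * gKinv = scal (qroot CARD('p) ^ 2) * (gKinv * gE)"
proof -
  have "(gE :: 'p uq) * gKinv = gKinv * (gK * gE * gKinv)"
    by (simp add: uq_relations(2) flip: mult.assoc)
  then show ?thesis by (simp add: uq_relations(3) mult_scal_left)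
qed

lemma gF_gKinv: "(gF :: 'p::finite uq) * gKinv = scal (inverse (qroot CARD('p)) ^ 2) * (gKinv * gF)"
proof -
  have "(gF :: 'p uq) * gKinv = gKinv * (gK * gF * gKinv)"
    by (simp add: uq_relations(2) flip: mult.assoc)
  then show ?thesis by (simp add: uq_relations(4) mult_scal_left)
qed

lemma casimir_EF:
  defines "q \<equiv> qroot CARD('p::finite)"
  shows "(casimir :: 'p uq) = gE * gF + (scal (inverse q / (q - inverse q) ^ 2) * gK
      + scal (q / (q - inverse q) ^ 2) * gKinv)"
  unfolding casimir_def Let_def q_def ring_distribs scal_mult_left by simp

text \<open>Replacing \<open>EF\<close> by \<open>FE\<close> plus the commutator exchanges the two
  scalars, because \<open>1/d = q/d^2 - q^(-1)/d^2\<close>.\<close>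

lemma casimir_FE:
  assumes "2 \<le> CARD('p::finite)"
  defines "q \<equiv> qroot CARD('p)"
  shows "(casimir :: 'p uq) = gF * gE + (scal (q / (q - inverse q) ^ 2) * gK
      + scal (inverse q / (q - inverse q) ^ 2) * gKinv)"
proof -
  define d where "d = q - inverse q"
  have d: "d \<noteq> 0" using qroot_diff_neq_0 [OF assms(1)] by (simp add: d_def q_def)
  have EF: "(gE :: 'p uq) * gF = gF * gE + scal (1 / d) * (gK - gKinv)"
    using uq_relations(5)[where 'p='p] by (simp add: d_def q_def algebra_simps)
  have "1 / d = d / d ^ 2"
    using d by (simp add: power2_eq_square)
  then have "1 / d = q / d ^ 2 - inverse q / d ^ 2"
    by (simp add: d_def diff_divide_distrib)
  then have *: "scal (q / d ^ 2) = (scal (1 / d) + scal (inverse q / d ^ 2) :: 'p uq)"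
    by (metis scal_add diff_add_cancel)
  show ?thesis
    unfolding casimir_EF [where 'p='p, folded q_def] d_def [symmetric] EF *
    by (simp add: algebra_simps)
qed

text \<open>For \<open>E\<close>, the \<open>EF\<close> form of the Casimir element is used on the
  left of \<open>E\<close> and the \<open>FE\<close> form on the right; moving \<open>K\<close> past
  \<open>E\<close> exchanges the scalars \<open>a\<close> and \<open>b\<close>. \<open>F\<close> is
  dual.\<close>

lemma casimir_commute:
  assumes "2 \<le> CARD('p::finite)"
  shows "casimir * x = x * (casimir :: 'p uq)"
proof -
  let ?q = "qroot CARD('p)"
  obtain a b where ab: "a * ?q ^ 2 = b" "b * inverse ?q ^ 2 = a"
    and EF: "(casimir :: 'p uq) = gE * gF + (scal a * gK + scal b * gKinv)"
    and FE: "(casimir :: 'p uq) = gF * gE + (scal b * gK + scal a * gKinv)"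
    using casimir_EF casimir_FE [OF assms]
    by (rule_tac that) (simp_all add: power2_eq_square)
  note simps = ring_distribs mult.assoc scal_out scal_mult_left ab
  have E: "casimir * gE = gE * (casimir :: 'p uq)"
    by (subst EF, subst FE) (simp add: simps gK_gE gE_gKinv)
  have F: "casimir * gF = gF * (casimir :: 'p uq)"
    by (subst FE, subst EF) (simp add: simps gK_gF gF_gKinv)
  have EFK: "(gK :: 'p uq) * (gE * gF) = gE * (gF * gK)"
  proof -
    have "(gK :: 'p uq) * (gE * gF) = gK * gE * gF" by (simp add: mult.assoc)
    also have "\<dots> = scal (?q ^ 2) * (gE * (gK * gF))" by (simp add: gK_gE mult.assoc)
    also have "\<dots> = gE * (gF * gK)"
      by (simp add: gK_gF scal_out scal_mult_left flip: power_mult_distrib)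
    finally show ?thesis .
  qed
  have K: "casimir * gK = gK * (casimir :: 'p uq)"
    by (simp add: EF simps EFK uq_relations(1,2))
  have "casimir * gKinv = gKinv * (gK * casimir) * (gKinv :: 'p uq)"
    by (simp add: uq_relations(2) flip: mult.assoc)
  also have "\<dots> = gKinv * casimir"
    unfolding K [symmetric] by (simp add: mult.assoc uq_relations(1))
  finally have Kinv: "casimir * gKinv = gKinv * (casimir :: 'p uq)" .
  show ?thesis
  proof (induction x rule: uq_induct)
    case (5 c)
    show ?case by (simp add: scal_commute)
  next
    case (7 x y)
    then show ?case by (metis mult.assoc)
  qed (simp_all add: E F K Kinv ring_distribs)
qed

text \<open>The element \<open>N\<close> of the overview. The sign covers both families, as
  \<open>- casimir_eigenvalue p s\<close> is the eigenvalue of index \<open>p - s\<close>.\<close>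

definition cas_nil :: "complex \<Rightarrow> nat \<Rightarrow> 'p::finite uq" where
  "cas_nil \<alpha> s = casimir - scal (\<alpha> * casimir_eigenvalue CARD('p) s)"

lemma cas_nil_commute:
  assumes "2 \<le> CARD('p::finite)"
  shows "cas_nil \<alpha> s * x = x * (cas_nil \<alpha> s :: 'p uq)"
  by (simp add: cas_nil_def left_diff_distrib right_diff_distrib casimir_commute [OF assms] scal_commute)

lemma gKinv_weight:
  fixes x :: "'p::finite uq"
  assumes "gK * x = scal c * x" "c \<noteq> 0"
  shows "gKinv * x = scal (inverse c) * x"
proof -
  have "x = gKinv * (gK * x)"
    by (simp add: uq_relations(2) flip: mult.assoc)
  then have "x = scal c * (gKinv * x)"
    by (simp add: assms scal_out)
  then have "scal (inverse c) * x = scal (inverse c) * (scal c * (gKinv * x))" by simp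
  then show ?thesis using assms(2) by (simp add: scal_mult_left)
qed

lemma gK_power_weight:
  fixes x :: "'p::finite uq"
  assumes "gK * x = scal c * x"
  shows "gK ^ n * x = scal (c ^ n) * x"
  by (induction n) (simp_all add: mult.assoc scal_out assms scal_mult_left mult.commute)

lemma gE_weight:
  fixes x :: "'p::finite uq"
  assumes "gK * x = scal c * x"
  shows "gK * (gE ^ i * x) = scal (qroot CARD('p) ^ (2 * i) * c) * (gE ^ i * x)"
proof (induction i)
  case (Suc i)
  have "gK * (gE ^ Suc i * x) = gK * gE * (gE ^ i * x)" by (simp add: mult.assoc)
  also have "\<dots> = scal (qroot CARD('p) ^ 2) * (gE * (gK * (gE ^ i * x)))"
    by (simp add: gK_gE mult.assoc)
  finally show ?case
    unfolding Suc by (simp add: scal_out scal_mult_left mult.assoc power2_eq_square)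
qed (simp add: assms)

lemma gF_weight:
  fixes x :: "'p::finite uq"
  assumes "gK * x = scal c * x"
  shows "gK * (gF ^ i * x) = scal (inverse (qroot CARD('p)) ^ (2 * i) * c) * (gF ^ i * x)"
proof (induction i)
  case (Suc i)
  have "gK * (gF ^ Suc i * x) = gK * gF * (gF ^ i * x)" by (simp add: mult.assoc)
  also have "\<dots> = scal (inverse (qroot CARD('p)) ^ 2) * (gF * (gK * (gF ^ i * x)))"
    by (simp add: gK_gF mult.assoc)
  finally show ?case
    unfolding Suc by (simp add: scal_out scal_mult_left mult.assoc power2_eq_square)
qed (simp add: assms)


text \<open>On a weight vector the \<open>K\<close>-terms of the Casimir element are scalars;
  subtracting its eigenvalue leaves \<open>N\<close> plus the shift.\<close>

lemma gE_gF_weight: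
  fixes x :: "'p::finite uq"
  assumes "\<alpha> * \<alpha> = 1" "gK * x = scal (wt CARD('p) \<alpha> s j) * x"
  shows "gE * (gF * x) = (cas_nil \<alpha> s + scal (cas_shift CARD('p) \<alpha> s j)) * x"
proof -
  have "casimir * x = gE * (gF * x) +
     scal (\<alpha> * casimir_eigenvalue CARD('p) s - cas_shift CARD('p) \<alpha> s j) * x"
    unfolding cas_shift_wt [OF assms(1)] casimir_EF
    by (simp add: ring_distribs mult.assoc assms(2) gKinv_weight [OF assms(2) wt_neq_0 [OF assms(1)]]
        scal_mult_left scal_add)
  then show ?thesis
    by (simp add: cas_nil_def scal_diff algebra_simps)
qed

text \<open>\<open>FE\<close> at index \<open>j + 1\<close> passes through index \<open>j\<close>,
  hence has the factor that \<open>EF\<close> has there.\<close>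

lemma gF_gE_weight:
  fixes x :: "'p::finite uq"
  assumes "2 \<le> CARD('p)" "\<alpha> * \<alpha> = 1" "gK * x = scal (wt CARD('p) \<alpha> s (Suc j)) * x"
  shows "gF * (gE * x) = (cas_nil \<alpha> s + scal (cas_shift CARD('p) \<alpha> s j)) * x"
proof -
  have "casimir * x = gF * (gE * x) +
     scal (\<alpha> * casimir_eigenvalue CARD('p) s - cas_shift CARD('p) \<alpha> s j) * x"
    unfolding cas_shift_wt_Suc [OF assms(2)] casimir_FE [OF assms(1)]
    by (simp add: ring_distribs mult.assoc assms(3) gKinv_weight [OF assms(3) wt_neq_0 [OF assms(2)]]
        scal_mult_left scal_add)
  then show ?thesis
    by (simp add: cas_nil_def scal_diff algebra_simps)
qed

section \<open>Polynomials in a central element\<close>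

text \<open>The ring \<open>'p uq\<close> is not commutative, so \<open>poly\<close> does not apply to it.\<close>

definition poly_uq :: "complex poly \<Rightarrow> 'p::finite uq \<Rightarrow> 'p uq" where
  "poly_uq P x = fold_coeffs (\<lambda>c y. scal c + x * y) P 0"

lemma poly_uq_0 [simp]: "poly_uq 0 x = 0"
  by (simp add: poly_uq_def)

lemma poly_uq_pCons [simp]: "poly_uq (pCons c P) x = scal c + x * poly_uq P x"
  by (cases "c = 0 \<and> P = 0") (auto simp: poly_uq_def)

lemma poly_uq_1 [simp]: "poly_uq 1 x = 1"
  by (simp add: one_pCons)

lemma poly_uq_add: "poly_uq (P + Q) x = poly_uq P x + poly_uq Q x"
  by (induction P Q rule: poly_induct2) (simp_all add: scal_add algebra_simps)

lemma poly_uq_smult: "poly_uq (smult c P) x = scal c * poly_uq P x"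
  by (induction P) (simp_all add: scal_mult mult_scal_left [of x] ring_distribs)

lemma poly_uq_mult: "poly_uq (P * Q) x = poly_uq P x * poly_uq Q x"
  by (induction P) (simp_all add: poly_uq_add poly_uq_smult ring_distribs mult.assoc)

lemma poly_uq_sum: "poly_uq (\<Sum>i\<in>A. f i) x = (\<Sum>i\<in>A. poly_uq (f i) x)"
  by (induction A rule: infinite_finite_induct) (simp_all add: poly_uq_add)

lemma poly_uq_commute:
  assumes "x * y = y * x"
  shows "poly_uq P x * y = y * poly_uq P x"
proof (induction P)
  case (pCons c P)
  then show ?case by (simp add: ring_distribs scal_commute) (metis assms mult.assoc)
qed simp

lemma poly_uq_cas_nil_commute:
  assumes "2 \<le> CARD('p::finite)"
  shows "poly_uq P (cas_nil \<alpha> s) * y = y * (poly_uq P (cas_nil \<alpha> s) :: 'p uq)"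
  by (intro poly_uq_commute cas_nil_commute assms)

section \<open>Iterated products of \<open>E\<close> and \<open>F\<close> on weight vectors\<close>

lemma gF_power_wt:
  fixes x :: "'p::finite uq"
  assumes "gK * x = scal (wt CARD('p) \<alpha> s j) * x"
  shows "gK * (gF ^ k * x) = scal (wt CARD('p) \<alpha> s (j + k)) * (gF ^ k * x)"
proof -
  have "wt p \<alpha> s (j + k) = inverse (qroot p) ^ (2 * k) * wt p \<alpha> s j" for p
    by (induction k) (simp_all add: wt_Suc power2_eq_square)
  then show ?thesis using gF_weight [OF assms] by simp
qed

lemma gE_power_wt:
  fixes x :: "'p::finite uq"
  assumes "gK * x = scal (wt CARD('p) \<alpha> s (j + k)) * x"
  shows "gK * (gE ^ k * x) = scal (wt CARD('p) \<alpha> s j) * (gE ^ k * x)"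
proof -
  have "wt p \<alpha> s j = qroot p ^ (2 * k) * wt p \<alpha> s (j + k)" for p
    by (induction k) (simp_all add: wt_Suc field_simps power2_eq_square)
  then show ?thesis using gE_weight [OF assms] by simp
qed

definition cas_prod :: "nat \<Rightarrow> complex \<Rightarrow> nat \<Rightarrow> nat set \<Rightarrow> complex poly" where
  "cas_prod p \<alpha> s A = (\<Prod>j\<in>A. [:cas_shift p \<alpha> s j, 1:])"

lemma cas_prod_Suc:
  "t \<le> k \<Longrightarrow> cas_prod p \<alpha> s {t..<Suc k} = [:cas_shift p \<alpha> s k, 1:] * cas_prod p \<alpha> s {t..<k}"
  unfolding cas_prod_def by (subst prod.atLeastLessThan_Suc) (simp_all add: mult.commute)

lemma cas_prod_head:
  "t < k \<Longrightarrow> cas_prod p \<alpha> s {t..<k} = [:cas_shift p \<alpha> s t, 1:] * cas_prod p \<alpha> s {Suc t..<k}"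
  unfolding cas_prod_def by (rule prod.atLeast_Suc_lessThan)

lemma cas_prod_concat:
  "i \<le> j \<Longrightarrow> j \<le> k \<Longrightarrow> cas_prod p \<alpha> s {i..<j} * cas_prod p \<alpha> s {j..<k} = cas_prod p \<alpha> s {i..<k}"
  unfolding cas_prod_def by (rule prod.atLeastLessThan_concat)

text \<open>The innermost pair \<open>EF\<close> acts at index \<open>t + k\<close> as a linear
  polynomial in \<open>N\<close>, which is central and moves out.\<close>

lemma gE_power_gF_power:
  fixes x :: "'p::finite uq"
  assumes "2 \<le> CARD('p)" "\<alpha> * \<alpha> = 1" "gK * x = scal (wt CARD('p) \<alpha> s t) * x"
  shows "gE ^ k * (gF ^ k * x) = poly_uq (cas_prod CARD('p) \<alpha> s {t..<t + k}) (cas_nil \<alpha> s) * x"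
proof (induction k)
  case (Suc k)
  let ?P = "poly_uq [:cas_shift CARD('p) \<alpha> s (t + k), 1:] (cas_nil \<alpha> s) :: 'p uq"
  have "gE ^ Suc k * (gF ^ Suc k * x) = gE ^ k * (gE * (gF * (gF ^ k * x)))"
    unfolding power_Suc2 [of gE] by (simp add: mult.assoc)
  also have "\<dots> = gE ^ k * (?P * (gF ^ k * x))"
    by (simp add: gE_gF_weight [OF assms(2) gF_power_wt [OF assms(3)]] add.commute)
  also have "\<dots> = ?P * (gE ^ k * (gF ^ k * x))"
    by (metis mult.assoc poly_uq_cas_nil_commute [OF assms(1)])
  also have "\<dots> = poly_uq (cas_prod CARD('p) \<alpha> s {t..<t + Suc k}) (cas_nil \<alpha> s) * x"
    unfolding Suc by (simp only: cas_prod_Suc le_add1 add_Suc_right poly_uq_mult mult.assoc)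
  finally show ?case .
qed (simp add: cas_prod_def)

text \<open>The innermost pair \<open>FE\<close> contributes the factor of lowest index, so the
  induction hypothesis starts at \<open>Suc t\<close> and \<open>t\<close> is generalised.\<close>

lemma gF_power_gE_power:
  fixes x :: "'p::finite uq"
  assumes "2 \<le> CARD('p)" "\<alpha> * \<alpha> = 1" "gK * x = scal (wt CARD('p) \<alpha> s (t + k)) * x"
  shows "gF ^ k * (gE ^ k * x) = poly_uq (cas_prod CARD('p) \<alpha> s {t..<t + k}) (cas_nil \<alpha> s) * x"
  using assms(3)
proof (induction k arbitrary: t)
  case (Suc k)
  let ?P = "poly_uq [:cas_shift CARD('p) \<alpha> s t, 1:] (cas_nil \<alpha> s) :: 'p uq"
  have wt: "gK * x = scal (wt CARD('p) \<alpha> s (Suc t + k)) * x" using Suc.prems by simp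
  have "gF ^ Suc k * (gE ^ Suc k * x) = gF ^ k * (gF * (gE * (gE ^ k * x)))"
    unfolding power_Suc2 [of gF] by (simp add: mult.assoc)
  also have "\<dots> = gF ^ k * (?P * (gE ^ k * x))"
    by (simp add: gF_gE_weight [OF assms(1,2) gE_power_wt [OF wt]] add.commute)
  also have "\<dots> = ?P * (gF ^ k * (gE ^ k * x))"
    by (metis mult.assoc poly_uq_cas_nil_commute [OF assms(1)])
  also have "\<dots> = poly_uq (cas_prod CARD('p) \<alpha> s {t..<t + Suc k}) (cas_nil \<alpha> s) * x"
    unfolding Suc.IH [OF wt]
    by (simp only: add_Suc add_Suc_right cas_prod_head [OF less_add_Suc1] poly_uq_mult mult.assoc)
  finally show ?case .
qed (simp add: cas_prod_def)

section \<open>The elements as polynomials in the Casimir element\<close>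

lemma smult_sum_right: "smult c (\<Sum>i\<in>A. f i) = (\<Sum>i\<in>A. smult c (f i))"
  using sum_distrib_left [of "[:c:]" f A] by simp

text \<open>From \<open>n\<close> to \<open>n + 1\<close> the new factor splits as
  \<open>X + d n\<close>: the summand \<open>m = 1\<close> supplies the multiple of
  \<open>X\<close>, and the others are \<open>d n\<close> times the sum for
  \<open>n\<close>.\<close>

lemma telescoping_prod:
  fixes d :: "nat \<Rightarrow> complex"
  assumes "1 \<le> n"
  shows "(\<Sum>m = 1..n. smult (\<Prod>j = n - (m - 1)..n - 1. d j)
      (if m = n then 1 else pCons 0 (\<Prod>i\<in>{1..<n - m}. [:d i, 1:]))) = (\<Prod>i\<in>{1..<n}. [:d i, 1:])"
  using assms
proof (induction n rule: dec_induct)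
  case (step n)
  let ?f = "\<lambda>n m. smult (\<Prod>j = n - (m - 1)..n - 1. d j)
      (if m = n then 1 else pCons 0 (\<Prod>i\<in>{1..<n - m}. [:d i, 1:]))"
  have "(\<Sum>m = 1..Suc n. ?f (Suc n) m) = ?f (Suc n) 1 + (\<Sum>m = 1..n. ?f (Suc n) (Suc m))"
    unfolding One_nat_def
    by (subst sum.atLeast_Suc_atMost, simp, subst sum.shift_bounds_cl_Suc_ivl) (rule HOL.refl)
  also have "(\<Sum>m = 1..n. ?f (Suc n) (Suc m)) = (\<Sum>m = 1..n. smult (d n) (?f n m))"
  proof (rule sum.cong [OF HOL.refl])
    fix m assume m: "m \<in> {1..n}"
    then have *: "{Suc n - (Suc m - 1)..Suc n - 1} = insert n {n - (m - 1)..n - 1}"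
      using step by auto
    show "?f (Suc n) (Suc m) = smult (d n) (?f n m)"
      unfolding * using m step by (subst prod.insert) auto
  qed
  also have "\<dots> = smult (d n) (\<Prod>i\<in>{1..<n}. [:d i, 1:])"
    unfolding smult_sum_right [symmetric] step.IH ..
  also have "?f (Suc n) 1 = pCons 0 (\<Prod>i\<in>{1..<n}. [:d i, 1:])"
    using step by simp
  finally show ?case
    using step.hyps(1) by (simp add: prod.atLeastLessThan_Suc add.commute mult.commute [of _ "[:d n, 1:]"])
qed simp

text \<open>The polynomial \<open>H\<close> of the overview: the factors of indices \<open>1\<close>
  to \<open>p - 1\<close> without the factor \<open>X\<close> at index \<open>s\<close>, written so
  as to match \<open>gam\<close> and \<open>del\<close>.\<close>

definition red_prod :: "nat \<Rightarrow> complex \<Rightarrow> nat \<Rightarrow> complex poly" where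
  "red_prod p \<alpha> s = (\<Prod>j = 1..s - 1. [:\<alpha> * qnum p j * qnum p (s - j), 1:]) *
    (\<Prod>i = 1..p - s - 1. [:- \<alpha> * qnum p i * qnum p (p - s - i), 1:])"

lemma cas_prod_low: "cas_prod p \<alpha> s {1..<s} = (\<Prod>j = 1..s - 1. [:\<alpha> * qnum p j * qnum p (s - j), 1:])"
proof -
  have "{1..<s} = {1..s - 1}" by auto
  then show ?thesis
    unfolding cas_prod_def by (auto simp: cas_shift_low intro!: prod.cong)
qed

text \<open>The shift vanishes at index \<open>s\<close>, which contributes the factor
  \<open>X\<close>; the later factors come from \<open>cas_shift_high\<close>.\<close>

lemma cas_prod_past:
  assumes "0 < k" "k \<le> p - s" "1 \<le> s" "s < p"
  shows "cas_prod p \<alpha> s {1..<s + k} = pCons 0 (cas_prod p \<alpha> s {1..<s} *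
    (\<Prod>i\<in>{1..<k}. [:- \<alpha> * qnum p i * qnum p (p - s - i), 1:]))"
proof -
  have "cas_prod p \<alpha> s {Suc s..<s + k} = (\<Prod>i\<in>{1..<k}. [:cas_shift p \<alpha> s (s + i), 1:])"
    using prod.atLeastLessThan_shift_bounds [of "\<lambda>j. [:cas_shift p \<alpha> s j, 1:]" 1 s k]
    by (simp add: cas_prod_def add.commute)
  also have "\<dots> = (\<Prod>i\<in>{1..<k}. [:- \<alpha> * qnum p i * qnum p (p - s - i), 1:])"
    using assms by (intro prod.cong HOL.refl) (simp add: cas_shift_high)
  finally have "cas_prod p \<alpha> s {s..<s + k} =
      pCons 0 (\<Prod>i\<in>{1..<k}. [:- \<alpha> * qnum p i * qnum p (p - s - i), 1:])"
    using assms by (simp add: cas_prod_head [of s "s + k"])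
  then show ?thesis
    using cas_prod_concat [of 1 s "s + k" p \<alpha> s] assms by simp
qed

lemma red_prod_eq:
  "red_prod p \<alpha> s = cas_prod p \<alpha> s {1..<s} *
    (\<Prod>i\<in>{1..<p - s}. [:- \<alpha> * qnum p i * qnum p (p - s - i), 1:])"
proof -
  have "{1..<p - s} = {1..p - s - 1}" by auto
  then show ?thesis by (simp only: red_prod_def cas_prod_low)
qed

lemma cas_prod_full:
  assumes "1 \<le> s" "s < p"
  shows "cas_prod p \<alpha> s {1..<p} = pCons 0 (red_prod p \<alpha> s)"
  using cas_prod_past [of "p - s" p s \<alpha>] assms by (simp add: red_prod_eq)

text \<open>Up to the common factor \<open>?L\<close> this is \<open>telescoping_prod\<close> with
  \<open>n = p - s\<close>.\<close>

lemma sum_mu_cas_prod: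
  assumes "1 \<le> s" "s < p"
  shows "(\<Sum>m = 1..p - s. smult (mu p \<alpha> m s) (cas_prod p \<alpha> s {1..<p - m})) = red_prod p \<alpha> s"
proof -
  let ?d = "\<lambda>i. - \<alpha> * qnum p i * qnum p (p - s - i)"
  let ?L = "cas_prod p \<alpha> s {1..<s}"
  have "(\<Sum>m = 1..p - s. smult (mu p \<alpha> m s) (cas_prod p \<alpha> s {1..<p - m})) =
      (\<Sum>m = 1..p - s. ?L * smult (\<Prod>j = (p - s) - (m - 1)..(p - s) - 1. ?d j)
        (if m = p - s then 1 else pCons 0 (\<Prod>i\<in>{1..<p - s - m}. [:?d i, 1:])))"
  proof (rule sum.cong [OF HOL.refl])
    fix m assume m: "m \<in> {1..p - s}"
    show "smult (mu p \<alpha> m s) (cas_prod p \<alpha> s {1..<p - m}) =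
      ?L * smult (\<Prod>j = (p - s) - (m - 1)..(p - s) - 1. ?d j)
        (if m = p - s then 1 else pCons 0 (\<Prod>i\<in>{1..<p - s - m}. [:?d i, 1:]))"
    proof (cases "m = p - s")
      \<comment> \<open>Here the range stops just before index \<open>s\<close>, so the factor
        \<open>X\<close> is absent.\<close>
      case True
      then have "p - m = s" using assms by simp
      then show ?thesis using True by (simp add: mu_def)
    next
      case False
      then have "p - m = s + (p - s - m)" using m assms by auto
      moreover have "cas_prod p \<alpha> s {1..<s + (p - s - m)} =
          pCons 0 (?L * (\<Prod>i\<in>{1..<p - s - m}. [:?d i, 1:]))"
        using False m assms by (intro cas_prod_past) auto
      ultimately show ?thesis using False by (simp add: mu_def)
    qed
  qed
  also have "\<dots> = ?L * (\<Prod>i\<in>{1..<p - s}. [:?d i, 1:])"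
    unfolding sum_distrib_left [symmetric] using assms by (subst telescoping_prod) simp_all
  finally show ?thesis unfolding red_prod_eq .
qed

lemma gam_eq_coeff: "gam p \<alpha> s = 2 * of_nat p * coeff (red_prod p \<alpha> s) 0"
  by (simp add: gam_def red_prod_def poly_prod flip: poly_0_coeff_0)

text \<open>The linear coefficient is the derivative at \<open>0\<close>; the product rule gives the
  two sums of \<open>del\<close>.\<close>

lemma del_eq_coeff: "del p \<alpha> s = 2 * of_nat p * coeff (red_prod p \<alpha> s) 1"
proof -
  have "coeff (red_prod p \<alpha> s) 1 = poly (pderiv (red_prod p \<alpha> s)) 0"
    by (simp add: coeff_pderiv poly_0_coeff_0)
  also have "\<dots> = del p \<alpha> s / (2 * of_nat p)" if "p > 0"
    using that
    by (simp add: red_prod_def del_def pderiv_mult pderiv_prod poly_prod poly_sum pderiv_pCons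
        field_simps)
  finally show ?thesis by (cases "p = 0") (simp_all add: del_def)
qed

lemma coeff_red_prod_neq_0:
  assumes "\<alpha> \<noteq> 0" "s < p"
  shows "coeff (red_prod p \<alpha> s) 0 \<noteq> 0"
proof -
  have "qnum p j \<noteq> 0" if "j \<in> {1..s - 1} \<union> (\<lambda>i. s - i) ` {1..s - 1} \<union> {1..p - s - 1}
      \<union> (\<lambda>i. p - s - i) ` {1..p - s - 1}" for j
    using that assms(2) by (intro qnum_neq_0) auto
  then show ?thesis
    using assms(1) by (auto simp: red_prod_def poly_prod simp flip: poly_0_coeff_0)
qed

section \<open>The elements \<open>v\<close>, \<open>a\<close>, \<open>b\<close> and
  \<open>e\<close>\<close>

text \<open>Multiplication by \<open>K\<close> shifts the sum by one term, and the boundary terms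
  agree because \<open>K^(2p)\<close> and the \<open>2p\<close>-th power of the weight are both
  \<open>1\<close>.\<close>

lemma vv_weight:
  assumes "\<alpha> * \<alpha> = 1"
  shows "gK * vv \<alpha> s t = scal (wt CARD('p) \<alpha> s t) * (vv \<alpha> s t :: 'p::finite uq)"
proof -
  let ?n = "2 * CARD('p)" and ?l = "wt CARD('p) \<alpha> s t"
  define a where "a l = scal (inverse ?l ^ l) * (gK ^ l :: 'p uq)" for l
  have v: "vv \<alpha> s t = (\<Sum>l<?n. a l)"
    by (simp only: vv_def a_def inverse_wt [OF assms])
  have *: "?l * inverse ?l ^ Suc l = inverse ?l ^ l" for l
    using wt_neq_0 [OF assms, of "CARD('p)" s t] by simp
  have "gK * a l = scal ?l * a (Suc l)" for l
    unfolding a_def scal_mult_left * by (simp add: scal_out)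
  then have "gK * vv \<alpha> s t = scal ?l * (\<Sum>l<?n. a (Suc l))"
    by (simp add: v sum_distrib_left)
  also have "(\<Sum>l<?n. a (Suc l)) + a 0 = (\<Sum>l<?n. a l) + a ?n"
    by (metis sum.lessThan_Suc sum.lessThan_Suc_shift add.commute)
  then have "(\<Sum>l<?n. a (Suc l)) = (\<Sum>l<?n. a l)"
    using wt_power_2p [OF assms, of "CARD('p)" s t]
    by (simp add: a_def uq_relations(8) power_inverse)
  finally show ?thesis by (simp add: v)
qed

lemma vv_mult_weight:
  fixes x :: "'p::finite uq"
  assumes "\<alpha> * \<alpha> = 1" "gK * x = scal (wt CARD('p) \<alpha> s t) * x"
  shows "vv \<alpha> s t * x = scal (2 * of_nat CARD('p)) * x"
proof -
  have "vv \<alpha> s t * x = (\<Sum>l<2 * CARD('p). scal ((inverse (wt CARD('p) \<alpha> s t) * wt CARD('p) \<alpha> s t) ^ l) * x)"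
    unfolding vv_def inverse_wt [OF assms(1), symmetric] sum_distrib_right power_mult_distrib
    by (simp add: mult.assoc gK_power_weight [OF assms(2)] scal_mult)
  also have "\<dots> = of_nat (2 * CARD('p)) * x"
    using wt_neq_0 [OF assms(1)] by simp
  finally show ?thesis
    by (metis scal_of_nat of_nat_mult of_nat_numeral)
qed

lemma vv_commute: "gK * vv \<alpha> s t = vv \<alpha> s t * (gK :: 'p::finite uq)"
  by (simp add: vv_def sum_distrib_left sum_distrib_right scal_out mult.assoc power_commutes)

context
  fixes \<alpha> :: complex and s t :: nat and N v :: "'p::finite uq"
  assumes p: "2 \<le> CARD('p)" and \<alpha>: "\<alpha> * \<alpha> = 1" and s: "1 \<le> s" "s < CARD('p)" and t: "1 \<le> t" "t \<le> s"
  defines "N \<equiv> cas_nil \<alpha> s" and "v \<equiv> vv \<alpha> s t"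
begin

lemma v_weight: "gK * v = scal (wt CARD('p) \<alpha> s t) * v"
  unfolding v_def by (rule vv_weight [OF \<alpha>])

text \<open>\<open>E^k F^k\<close> returns to index \<open>t\<close> and collects the factors from
  \<open>t\<close> to \<open>t + k - 1\<close>; \<open>F^i E^i\<close> then adds those from
  \<open>t - i\<close> to \<open>t - 1\<close>.\<close>

lemma FEF_v:
  assumes "i \<le> t" "k + t \<le> CARD('p)"
  shows "gF ^ i * gE ^ (i + k) * gF ^ k * v = poly_uq (cas_prod CARD('p) \<alpha> s {t - i..<t + k}) N * v"
proof -
  define y where "y = gE ^ k * (gF ^ k * v)"
  have y: "y = poly_uq (cas_prod CARD('p) \<alpha> s {t..<t + k}) N * v"
    unfolding y_def N_def by (rule gE_power_gF_power [OF p \<alpha> v_weight])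
  have "gK * y = scal (wt CARD('p) \<alpha> s t) * y"
    unfolding y_def by (intro gE_power_wt gF_power_wt v_weight)
  then have "gF ^ i * (gE ^ i * y) = poly_uq (cas_prod CARD('p) \<alpha> s {t - i..<t}) N * y"
    using gF_power_gE_power [OF p \<alpha>, of y s "t - i" i] assms by (simp add: N_def)
  also have "\<dots> = poly_uq (cas_prod CARD('p) \<alpha> s {t - i..<t + k}) N * v"
    unfolding y mult.assoc [symmetric] poly_uq_mult [symmetric]
    by (subst cas_prod_concat) simp_all
  finally show ?thesis by (simp add: y_def power_add mult.assoc)
qed

text \<open>With \<open>i = t - 1\<close> and \<open>k = p - t\<close> the factors have indices
  \<open>1\<close> to \<open>p - 1\<close>, and the one at \<open>s\<close> is
  \<open>X\<close>.\<close>

lemma aa_eq: "aa \<alpha> (t - 1) s t = poly_uq (pCons 0 (red_prod CARD('p) \<alpha> s)) N * v"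
proof -
  have "t - 1 + (CARD('p) - t) = CARD('p) - 1" "t - (t - 1) = 1" "t + (CARD('p) - t) = CARD('p)"
    using s t by simp_all
  then show ?thesis
    using FEF_v [of "t - 1" "CARD('p) - t"] s t cas_prod_full [OF s, of \<alpha>] by (simp add: aa_def v_def)
qed

text \<open>The summand \<open>m\<close> covers the indices \<open>1\<close> to
  \<open>p - m - 1\<close>, and the scalars \<open>mu\<close> make the sum telescope.\<close>

lemma bb_eq: "bb \<alpha> (t - 1) s t = poly_uq (red_prod CARD('p) \<alpha> s) N * v"
proof -
  have "bb \<alpha> (t - 1) s t = (\<Sum>m = 1..CARD('p) - s. scal (mu CARD('p) \<alpha> m s) *
      (gF ^ (t - 1) * gE ^ (CARD('p) - m - 1) * gF ^ (CARD('p) - t - m) * v))"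
    by (simp add: bb_def v_def sum_distrib_left scal_out mult.assoc)
  also have "\<dots> = (\<Sum>m = 1..CARD('p) - s. poly_uq (smult (mu CARD('p) \<alpha> m s) (cas_prod CARD('p) \<alpha> s {1..<CARD('p) - m})) N * v)"
  proof (rule sum.cong [OF HOL.refl])
    fix m assume m: "m \<in> {1..CARD('p) - s}"
    have "t - 1 + (CARD('p) - t - m) = CARD('p) - m - 1" "t - (t - 1) = 1"
      "t + (CARD('p) - t - m) = CARD('p) - m"
      using s t m by auto
    then show "scal (mu CARD('p) \<alpha> m s) *
        (gF ^ (t - 1) * gE ^ (CARD('p) - m - 1) * gF ^ (CARD('p) - t - m) * v) =
        poly_uq (smult (mu CARD('p) \<alpha> m s) (cas_prod CARD('p) \<alpha> s {1..<CARD('p) - m})) N * v"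
      using FEF_v [of "t - 1" "CARD('p) - t - m"] s t by (simp add: poly_uq_smult mult.assoc)
  qed
  finally show ?thesis
    by (simp only: sum_distrib_right [symmetric] poly_uq_sum [symmetric] sum_mu_cas_prod [OF s])
qed

text \<open>Taking \<open>i = t\<close> instead of \<open>t - 1\<close> makes the middle power
  \<open>E^p = 0\<close> and adds the index \<open>0\<close>, whose factor is a second
  \<open>X\<close>.\<close>

lemma red_prod_annihilates: "poly_uq (pCons 0 (pCons 0 (red_prod CARD('p) \<alpha> s))) N * v = 0"
proof -
  have "gF ^ t * gE ^ (t + (CARD('p) - t)) * gF ^ (CARD('p) - t) * v = 0"
    using s t by (simp add: uq_relations(6))
  moreover have "cas_prod CARD('p) \<alpha> s {0..<CARD('p)} = pCons 0 (cas_prod CARD('p) \<alpha> s {1..<CARD('p)})"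
    by (simp add: cas_prod_head)
  ultimately show ?thesis
    using FEF_v [of t "CARD('p) - t"] s t by (simp add: cas_prod_full [OF s, of \<alpha>, simplified] del: poly_uq_pCons)
qed

text \<open>Collects what the rest uses: the constant term for being nonzero, the product form for
  weights and orthogonality, the last two facts for primitivity and the block.\<close>

lemma ee_as_poly:
  obtains G where "coeff G 0 = 1"
    and "ee \<alpha> s t = poly_uq G N * (scal (1 / (2 * of_nat CARD('p))) * v)"
    and "ee \<alpha> s t * ee \<alpha> s t = (ee \<alpha> s t :: 'p uq)"
    and "N * (N * ee \<alpha> s t) = 0"
proof -
  define H where "H = red_prod CARD('p) \<alpha> s"
  define h r where "h = coeff H 0" and "r = coeff H 1 / h"
  \<comment> \<open>The factor \<open>smult (1 / h) [:1, - r:]\<close> is the inverse of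
    \<open>H\<close> modulo \<open>X^2\<close>.\<close>
  define G where "G = H * smult (1 / h) [:1, - r:]"
  define w where "w = scal (1 / (2 * of_nat CARD('p))) * v"
  have h: "h \<noteq> 0" unfolding h_def H_def using \<alpha> s by (intro coeff_red_prod_neq_0) auto
  have G_alt: "G = smult (1 / h) (H + smult (- r) (pCons 0 H))"
    by (simp add: G_def smult_add_right)
  have "coeff G 0 = 1" "coeff G 1 = 0"
    using h by (simp_all add: G_alt h_def r_def)
  then obtain R where R: "G - 1 = pCons 0 (pCons 0 R)"
    by (cases G; rename_tac a G'; case_tac G') (auto simp: one_pCons)
  have vv: "v * v = scal (2 * of_nat CARD('p)) * v"
    unfolding v_def by (rule vv_mult_weight [OF \<alpha> vv_weight [OF \<alpha>]])
  have ww: "w * w = w"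
    by (simp add: w_def mult.assoc mult_scal_left [of v] vv scal_mult_left)
  have Hw: "poly_uq (pCons 0 (pCons 0 H)) N * w = 0"
    unfolding w_def mult_scal_left [of "poly_uq _ _"] H_def red_prod_annihilates by simp
  have e: "ee \<alpha> s t = poly_uq G N * w"
  proof -
    have gd: "gam CARD('p) \<alpha> s = 2 * of_nat CARD('p) * h" "del CARD('p) \<alpha> s / gam CARD('p) \<alpha> s = r"
      by (simp_all add: gam_eq_coeff del_eq_coeff h_def r_def H_def)
    have "ee \<alpha> s t = poly_uq (smult (1 / gam CARD('p) \<alpha> s) (H + smult (- r) (pCons 0 H))) N * v"
      unfolding ee_def Let_def aa_eq bb_eq gd(2) H_def [symmetric] poly_uq_add poly_uq_smult
      by (simp only: scal_minus ring_distribs mult.assoc mult_minus_left diff_conv_add_uminus mult_minus_right)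
    also have "smult (1 / gam CARD('p) \<alpha> s) (H + smult (- r) (pCons 0 H)) =
        smult (1 / (2 * of_nat CARD('p))) G"
      by (simp add: gd G_alt mult.commute)
    finally show ?thesis
      by (simp add: w_def poly_uq_smult mult.assoc mult_scal_left [of "poly_uq _ _"])
  qed
  have Nc: "poly_uq P N * x = x * poly_uq P N" for P x
    unfolding N_def by (rule poly_uq_cas_nil_commute [OF p])
  have "poly_uq G N * w * (poly_uq G N * w) = poly_uq (G * G) N * w"
    by (metis Nc mult.assoc poly_uq_mult ww)
  \<comment> \<open>\<open>G\<close> has the factor \<open>H\<close> and \<open>G - 1\<close> the
    factor \<open>X^2\<close>, so \<open>G^2 - G\<close> is a multiple of \<open>X^2 H\<close>,
    which annihilates \<open>w\<close>.\<close>
  also have "G * G = G + smult (1 / h) [:1, - r:] * R * pCons 0 (pCons 0 H)"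
  proof -
    have "G * (G - 1) = smult (1 / h) [:1, - r:] * R * pCons 0 (pCons 0 H)"
      unfolding R by (simp add: G_def algebra_simps)
    then show ?thesis by (simp add: algebra_simps)
  qed
  also have "poly_uq \<dots> N * w = poly_uq G N * w"
    by (simp only: poly_uq_add poly_uq_mult [of _ "pCons 0 (pCons 0 H)"] ring_distribs
        mult.assoc [of _ _ w] Hw mult_zero_right add_0_right)
  finally have ee: "ee \<alpha> s t * ee \<alpha> s t = (ee \<alpha> s t :: 'p uq)"
    unfolding e .
  have "N * (N * ee \<alpha> s t) = poly_uq (smult (1 / h) [:1, - r:] * pCons 0 (pCons 0 H)) N * w"
    unfolding e G_def by (simp add: mult.assoc mult.commute [of H])
  also have "\<dots> = 0"
    unfolding poly_uq_mult mult.assoc Hw by simp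
  finally have "N * (N * ee \<alpha> s t) = 0" .
  then show thesis
    using that \<open>coeff G 0 = 1\<close> e ee unfolding w_def by blast
qed

end

section \<open>The simple modules\<close>

text \<open>
  Operators on all of \<open>nat \<Rightarrow> complex\<close>: coordinates \<open>n < s\<close> carry the simple module, and on the
  others \<open>E = F = 0\<close> and \<open>K = 1\<close>, so that the relations hold without restricting the support.
\<close>

primrec module_term ::
  "nat \<Rightarrow> complex \<Rightarrow> nat \<Rightarrow> uq_term \<Rightarrow> (nat \<Rightarrow> complex) \<Rightarrow> nat \<Rightarrow> complex" where
  "module_term p \<alpha> s TE = (\<lambda>u n. if Suc n < s then cas_shift p \<alpha> s (Suc n) * u (Suc n) else 0)"
| "module_term p \<alpha> s TF = (\<lambda>u n. case n of 0 \<Rightarrow> 0 | Suc m \<Rightarrow> if Suc m < s then u m else 0)"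
| "module_term p \<alpha> s TK = (\<lambda>u n. if n < s then wt p \<alpha> s (Suc n) * u n else u n)"
| "module_term p \<alpha> s TKinv = (\<lambda>u n. if n < s then inverse (wt p \<alpha> s (Suc n)) * u n else u n)"
| "module_term p \<alpha> s (TScal c) = (\<lambda>u n. c * u n)"
| "module_term p \<alpha> s (TAdd x y) = (\<lambda>u n. module_term p \<alpha> s x u n + module_term p \<alpha> s y u n)"
| "module_term p \<alpha> s (TMul x y) = (\<lambda>u. module_term p \<alpha> s x (module_term p \<alpha> s y u))"

text \<open>\<open>TMul\<close> is composition, so left distributivity and centrality of scalars
  rest on linearity.\<close>

lemma module_term_linear:
  "module_term p \<alpha> s x (\<lambda>n. c * u n + w n) =
    (\<lambda>n. c * module_term p \<alpha> s x u n + module_term p \<alpha> s x w n)"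
proof (induction x arbitrary: c u w)
  case (TMul x y)
  then show ?case by (simp only: module_term.simps)
qed (auto simp: fun_eq_iff algebra_simps split: nat.split)

lemma module_term_TPow: "module_term p \<alpha> s (TPow x k) u = (module_term p \<alpha> s x ^^ k) u"
  by (induction k) simp_all

text \<open>Lets the action descend to the quotient. Coordinate \<open>n\<close> carries the weight
  of index \<open>n + 1\<close>.\<close>

lemma module_term_cong:
  assumes "uq_eq p x y" "2 \<le> p" "\<alpha> * \<alpha> = 1" "s \<le> p"
  shows "module_term p \<alpha> s x = module_term p \<alpha> s y"
  using assms(1)
proof (induction rule: uq_eq.induct)
  have "wt p \<alpha> s j * inverse (wt p \<alpha> s (Suc j)) = qroot p ^ 2"
    and "wt p \<alpha> s (Suc j) * inverse (wt p \<alpha> s j) = inverse (qroot p) ^ 2" for j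
    using wt_neq_0 [OF assms(3), of p s j] by (simp_all add: wt_Suc power_inverse)
  then have ratio: "wt p \<alpha> s j * (c * (inverse (wt p \<alpha> s (Suc j)) * x)) = qroot p ^ 2 * (c * x)"
      "wt p \<alpha> s (Suc j) * (inverse (wt p \<alpha> s j) * x) = inverse (qroot p) ^ 2 * x" for j c x
    by (metis mult.assoc mult.left_commute)+
  {
  case (cong_mul x x' y y')
  then show ?case by simp
next
  case (distrib_left x y z)
  show ?case using module_term_linear [of p \<alpha> s x 1] by (simp add: fun_eq_iff)
next
  case (scal_central c x)
  have 0: "module_term p \<alpha> s x (\<lambda>n. 0) = (\<lambda>n. 0)"
    using module_term_linear [of p \<alpha> s x 1 "\<lambda>n. 0" "\<lambda>n. 0"] by (auto simp: fun_eq_iff)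
  show ?case using module_term_linear [of p \<alpha> s x c _ "\<lambda>n. 0"] by (simp add: fun_eq_iff 0)
next
  case rel_KE
  show ?case by (auto simp: fun_eq_iff ratio)
next
  case rel_KF
  show ?case by (auto simp: fun_eq_iff ratio split: nat.split)
next
  case rel_EF
  let ?d = "qroot p - inverse (qroot p)"
  \<comment> \<open>The shifts vanish at \<open>0\<close> and at \<open>s\<close>, so one formula
    covers both ends of the module.\<close>
  have "module_term p \<alpha> s (TDiff (TMul TE TF) (TMul TF TE)) u n =
      (if n < s then (cas_shift p \<alpha> s (Suc n) - cas_shift p \<alpha> s n) * u n else 0)" for u n
    by (cases "Suc n = s"; cases n) (auto simp: algebra_simps)
  then show ?case
    by (auto simp: fun_eq_iff cas_shift_Suc_diff [OF assms(3,2)] diff_divide_distrib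
        algebra_simps)
next
  case rel_E_pow
  \<comment> \<open>The case \<open>k = 0\<close> is excluded because coordinates beyond the module
    are killed by \<open>E\<close> but not by the identity.\<close>
  have "(module_term p \<alpha> s TE ^^ k) u n = 0" if "s \<le> n + k" "k > 0" for k u n
    using that
  proof (induction k arbitrary: n)
    case (Suc k)
    then show ?case by (cases "k = 0") auto
  qed simp
  then show ?case using assms by (simp add: fun_eq_iff module_term_TPow)
next
  case rel_F_pow
  have "(module_term p \<alpha> s TF ^^ k) u n = 0" if "n < k \<or> s \<le> n" "k > 0" for k u n
    using that
  proof (induction k arbitrary: n)
    case (Suc k)
    then show ?case by (cases "k = 0") (auto split: nat.split)
  qed simp
  from this [of _ p] have "(module_term p \<alpha> s TF ^^ p) u n = 0" for u n
    using assms by (metis le_trans not_less order.strict_trans2 zero_less_numeral)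
  then show ?case by (simp add: fun_eq_iff module_term_TPow)
next
  case rel_K_pow
  have "(module_term p \<alpha> s TK ^^ k) u n = (if n < s then wt p \<alpha> s (Suc n) ^ k * u n else u n)" for k u n
    by (induction k) auto
  then show ?case using wt_power_2p [OF assms(3)] assms(2) by (auto simp: fun_eq_iff module_term_TPow)
  }
qed (use wt_neq_0 [OF assms(3)] in \<open>auto simp: fun_eq_iff algebra_simps\<close>)

definition module_act :: "complex \<Rightarrow> nat \<Rightarrow> 'p::finite uq \<Rightarrow> (nat \<Rightarrow> complex) \<Rightarrow> nat \<Rightarrow> complex" where
  "module_act \<alpha> s x = module_term CARD('p) \<alpha> s (rep_uq x)"

context
  fixes \<alpha> :: complex and s t :: nat and A :: "'p::finite uq \<Rightarrow> (nat \<Rightarrow> complex) \<Rightarrow> nat \<Rightarrow> complex"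
  assumes p: "2 \<le> CARD('p)" and \<alpha>: "\<alpha> * \<alpha> = 1" and s: "s \<le> CARD('p)"
  defines "A \<equiv> module_act \<alpha> s"
begin

lemma module_act_abs: "A (abs_uq x) = module_term CARD('p) \<alpha> s x"
  unfolding A_def module_act_def
  by (rule module_term_cong [OF _ p \<alpha> s])
    (rule rep_abs_rsp_left [OF Quotient3_uq], rule uq_eq.refl)

lemma module_act_simps [simp]:
  "A (x + y) u n = A x u n + A y u n"
  "A (x * y) u = A x (A y u)"
  "A (scal c) u n = c * u n"
  "A 0 u n = 0"
  "A 1 u n = u n"
  "A gE u n = (if Suc n < s then cas_shift CARD('p) \<alpha> s (Suc n) * u (Suc n) else 0)"
  "A gF u n = (case n of 0 \<Rightarrow> 0 | Suc m \<Rightarrow> if Suc m < s then u m else 0)"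
  "A gK u n = (if n < s then wt CARD('p) \<alpha> s (Suc n) * u n else u n)"
  "A gKinv u n = (if n < s then inverse (wt CARD('p) \<alpha> s (Suc n)) * u n else u n)"
proof -
  obtain a b where "x = abs_uq a" "y = abs_uq b"
    by (metis Quotient3_abs_rep [OF Quotient3_uq])
  then show "A (x + y) u n = A x u n + A y u n" "A (x * y) u = A x (A y u)"
    by (simp_all add: plus_uq.abs_eq times_uq.abs_eq module_act_abs)
qed (simp_all add: scal.abs_eq gE_def gF_def gK_def gKinv_def zero_uq_def one_uq_def module_act_abs)

lemma module_act_poly:
  assumes "A x u = (\<lambda>n. 0)"
  shows "A (poly_uq P x) u = (\<lambda>n. coeff P 0 * u n)"
proof (induction P)
  case (pCons c Q)
  have "A x (\<lambda>n. coeff Q 0 * u n) n = coeff Q 0 * A x u n" for n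
    by (metis module_act_simps(2,3) scal_commute ext)
  then show ?case using assms by (intro ext) (simp add: pCons)
qed (simp add: fun_eq_iff)

text \<open>On the basis vector of weight index \<open>t\<close>, \<open>N\<close> acts as zero and
  \<open>v / 2p\<close> as the identity, so \<open>e\<close> acts as the constant term of
  \<open>G\<close>, which is \<open>1\<close>.\<close>

lemma ee_neq_0:
  assumes t: "1 \<le> t" "t \<le> s" and s': "s < CARD('p)"
  shows "ee \<alpha> s t \<noteq> (0 :: 'p uq)"
proof
  assume e0: "ee \<alpha> s t = (0 :: 'p uq)"
  define u :: "nat \<Rightarrow> complex" where "u n = (if n = t - 1 then 1 else 0)" for n
  have "1 \<le> s" using t by simp
  then obtain G where G: "coeff G 0 = 1"
    "ee \<alpha> s t = poly_uq G (cas_nil \<alpha> s) * (scal (1 / (2 * of_nat CARD('p))) * vv \<alpha> s t :: 'p uq)"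
    using ee_as_poly [OF p \<alpha> _ s' t] by metis
  have Au: "A (scal c) u = (\<lambda>n. c * u n)" for c by (simp add: fun_eq_iff)
  have K: "A gK u = A (scal (wt CARD('p) \<alpha> s t)) u"
    using t by (auto simp: fun_eq_iff u_def)
  have Kl: "A (gK ^ l) u = A (scal (wt CARD('p) \<alpha> s t ^ l)) u" for l
  proof (induction l)
    case (Suc l)
    have "A (gK ^ Suc l) u = A gK (A (scal (wt CARD('p) \<alpha> s t ^ l)) u)"
      by (simp only: power_Suc module_act_simps(2) Suc)
    also have "\<dots> = A (gK * scal (wt CARD('p) \<alpha> s t ^ l)) u" by simp
    also have "\<dots> = A (scal (wt CARD('p) \<alpha> s t ^ l)) (A gK u)"
      by (simp flip: scal_commute)
    also have "\<dots> = A (scal (wt CARD('p) \<alpha> s t ^ Suc l)) u"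
      by (simp add: K fun_eq_iff)
    finally show ?case .
  qed (simp add: fun_eq_iff)
  have sum: "A (\<Sum>l<k. f l) u n = (\<Sum>l<k. A (f l) u n)" for f :: "nat \<Rightarrow> 'p uq" and k n
    by (induction k) simp_all
  have "A (vv \<alpha> s t) u n = (\<Sum>l<2 * CARD('p). (inverse (wt CARD('p) \<alpha> s t) * wt CARD('p) \<alpha> s t) ^ l * u n)" for n
    unfolding vv_def inverse_wt [OF \<alpha>, symmetric] power_mult_distrib sum by (simp add: Kl mult.assoc)
  then have V: "A (scal (1 / (2 * of_nat CARD('p))) * vv \<alpha> s t) u = u"
    using wt_neq_0 [OF \<alpha>] by (simp add: fun_eq_iff)
  \<comment> \<open>At \<open>t = s\<close>, \<open>F\<close> kills the lowest vector and the shift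
    vanishes as well.\<close>
  have EF: "A (gE * gF) u = A (scal (cas_shift CARD('p) \<alpha> s t)) u"
    using t by (cases "t = s") (auto simp: fun_eq_iff u_def)
  have "A casimir u n = A (scal (\<alpha> * casimir_eigenvalue CARD('p) s)) u n" for n
    unfolding casimir_EF module_act_simps(1) EF
    using t by (auto simp: u_def cas_shift_wt [OF \<alpha>])
  then have "A (cas_nil \<alpha> s) u = (\<lambda>n. 0)"
    unfolding cas_nil_def diff_conv_add_uminus scal_minus [symmetric] by (simp add: fun_eq_iff)
  from module_act_poly [OF this, of G] G V
  have "A (ee \<alpha> s t) u = u" by simp
  then have "u = (\<lambda>n. 0)" by (simp add: e0 fun_eq_iff)
  then show False by (auto simp: fun_eq_iff u_def split: if_splits)
qed

end

section \<open>Primitivity\<close>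

context
  fixes N e :: "'p::finite uq" and \<alpha> \<mu> :: complex and s :: nat
  assumes p: "2 \<le> CARD('p)" and N: "N = cas_nil \<alpha> s" and e: "e * e = e" and Ne: "N * (N * e) = 0" and \<mu>: "\<mu> \<noteq> 0"
    and Ke: "gK * e = scal \<mu> * e" and eK: "e * gK = scal \<mu> * e"
begin

lemma N_commute: "N * x = x * N"
  unfolding N by (rule cas_nil_commute [OF p])

text \<open>A quotient of the dual numbers, with \<open>N e\<close> as the element of square
  zero.\<close>

definition local_part :: "'p uq set" where
  "local_part = {scal c * e + scal d * (N * e) | c d. True}"

lemma local_part_add: "x \<in> local_part \<Longrightarrow> y \<in> local_part \<Longrightarrow> x + y \<in> local_part"
proof -
  have "(scal c * e + scal d * (N * e)) + (scal c' * e + scal d' * (N * e)) =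
      scal (c + c') * e + scal (d + d') * (N * e)" for c c' d d'
    by (simp add: scal_add ring_distribs algebra_simps)
  then show "x \<in> local_part \<Longrightarrow> y \<in> local_part \<Longrightarrow> x + y \<in> local_part"
    unfolding local_part_def by blast
qed

lemma local_part_scal: "x \<in> local_part \<Longrightarrow> scal a * x \<in> local_part"
proof -
  have "scal a * (scal c * e + scal d * (N * e)) = scal (a * c) * e + scal (a * d) * (N * e)" for c d
    by (simp add: ring_distribs scal_mult_left)
  then show "x \<in> local_part \<Longrightarrow> scal a * x \<in> local_part"
    unfolding local_part_def by blast
qed

lemma local_part_N: "x \<in> local_part \<Longrightarrow> N * x \<in> local_part"
proof -
  have "N * (scal c * e + scal d * (N * e)) = scal 0 * e + scal c * (N * e)" for c d
    by (simp add: ring_distribs mult_scal_left [of N] Ne)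
  then show "x \<in> local_part \<Longrightarrow> N * x \<in> local_part"
    unfolding local_part_def by blast
qed

lemma local_part_weight:
  assumes "x \<in> local_part"
  shows "gK * x = scal \<mu> * x"
proof -
  have "gK * (N * e) = scal \<mu> * (N * e)"
    by (metis N_commute Ke mult.assoc mult_scal_left)
  then show ?thesis
    using assms unfolding local_part_def
    by (auto simp: ring_distribs scal_out Ke scal_mult_left mult.commute)
qed

section \<open>The left ideal generated by \<open>e\<close>\<close>

inductive_set left_span :: "'p uq set" where
  E: "x \<in> local_part \<Longrightarrow> gE ^ i * x \<in> left_span"
| F: "x \<in> local_part \<Longrightarrow> gF ^ i * x \<in> left_span"
| add: "x \<in> left_span \<Longrightarrow> y \<in> left_span \<Longrightarrow> x + y \<in> left_span"

text \<open>A form of \<open>gE_gF_weight\<close> for any nonzero weight. Only the shape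
  \<open>N\<close> plus a scalar matters, so the scalar stays unnamed.\<close>

lemma EF_weight:
  assumes "gK * x = scal c * x" "c \<noteq> 0"
  obtains d where "gE * (gF * x) = (N + scal d) * x"
proof -
  obtain a b where EF: "(casimir :: 'p uq) = gE * gF + (scal a * gK + scal b * gKinv)"
    using casimir_EF by blast
  have "casimir * x = gE * (gF * x) + scal (a * c + b * inverse c) * x"
    by (simp add: EF ring_distribs mult.assoc assms gKinv_weight [OF assms] scal_mult_left scal_add)
  then have "gE * (gF * x) = (N + scal (\<alpha> * casimir_eigenvalue CARD('p) s - (a * c + b * inverse c))) * x"
    by (simp add: N cas_nil_def scal_diff algebra_simps)
  then show thesis using that by blast
qed

lemma FE_weight:
  assumes "gK * x = scal c * x" "c \<noteq> 0"
  obtains d where "gF * (gE * x) = (N + scal d) * x"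
proof -
  obtain a b where FE: "(casimir :: 'p uq) = gF * gE + (scal a * gK + scal b * gKinv)"
    using casimir_FE [OF p] by blast
  have "casimir * x = gF * (gE * x) + scal (a * c + b * inverse c) * x"
    by (simp add: FE ring_distribs mult.assoc assms gKinv_weight [OF assms] scal_mult_left scal_add)
  then have "gF * (gE * x) = (N + scal (\<alpha> * casimir_eigenvalue CARD('p) s - (a * c + b * inverse c))) * x"
    by (simp add: N cas_nil_def scal_diff algebra_simps)
  then show thesis using that by blast
qed

text \<open>It suffices to treat generators. An \<open>E\<close> meeting \<open>F^(j+1) x\<close>
  cancels one \<open>F\<close> and leaves \<open>F^j (N + d) x\<close> with \<open>(N + d) x\<close>
  again in \<open>local_part\<close>; \<open>F\<close> on powers of \<open>E\<close> is dual, and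
  \<open>K\<close> acts by scalars.\<close>

lemma left_span_ideal:
  assumes "w \<in> left_span"
  shows "x * w \<in> left_span"
  using assms
proof (induction x arbitrary: w rule: uq_induct)
  case 1
  then show ?case
  proof (induction rule: left_span.induct)
    case (E x i)
    then show ?case using left_span.E [of x "Suc i"] by (simp add: mult.assoc)
  next
    case (F x i)
    show ?case
    proof (cases i)
      case 0
      then show ?thesis using left_span.E [OF F, of 1] by simp
    next
      case (Suc j)
      obtain d where "gE * (gF * (gF ^ j * x)) = (N + scal d) * (gF ^ j * x)"
        using EF_weight [OF gF_weight [OF local_part_weight [OF F]]] \<mu> by auto
      also have "\<dots> = gF ^ j * (N * x + scal d * x)"
        by (simp add: ring_distribs scal_out) (metis N_commute mult.assoc)
      finally show ?thesis
        using left_span.F local_part_add local_part_N local_part_scal F Suc by (simp add: mult.assoc)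
    qed
  qed (simp add: ring_distribs left_span.add)
next
  case 2
  then show ?case
  proof (induction rule: left_span.induct)
    case (F x i)
    then show ?case using left_span.F [of x "Suc i"] by (simp add: mult.assoc)
  next
    case (E x i)
    show ?case
    proof (cases i)
      case 0
      then show ?thesis using left_span.F [OF E, of 1] by simp
    next
      case (Suc j)
      obtain d where "gF * (gE * (gE ^ j * x)) = (N + scal d) * (gE ^ j * x)"
        using FE_weight [OF gE_weight [OF local_part_weight [OF E]]] \<mu> by auto
      also have "\<dots> = gE ^ j * (N * x + scal d * x)"
        by (simp add: ring_distribs scal_out) (metis N_commute mult.assoc)
      finally show ?thesis
        using left_span.E local_part_add local_part_N local_part_scal E Suc by (simp add: mult.assoc)
    qed
  qed (simp add: ring_distribs left_span.add)
next
  case 3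
  then show ?case
  proof (induction rule: left_span.induct)
    case (E x i)
    show ?case
      unfolding gE_weight [OF local_part_weight [OF E]] scal_out [symmetric]
      by (intro left_span.E local_part_scal E)
  next
    case (F x i)
    show ?case
      unfolding gF_weight [OF local_part_weight [OF F]] scal_out [symmetric]
      by (intro left_span.F local_part_scal F)
  qed (simp add: ring_distribs left_span.add)
next
  case 4
  then show ?case
  proof (induction rule: left_span.induct)
    case (E x i)
    have "gKinv * (gE ^ i * x) = scal (inverse (qroot CARD('p) ^ (2 * i) * \<mu>)) * (gE ^ i * x)"
      by (rule gKinv_weight [OF gE_weight [OF local_part_weight [OF E]]]) (simp add: \<mu>)
    then show ?case
      using left_span.E [OF local_part_scal [OF E]] by (simp add: scal_out)
  next
    case (F x i)
    have "gKinv * (gF ^ i * x) = scal (inverse (inverse (qroot CARD('p)) ^ (2 * i) * \<mu>)) * (gF ^ i * x)"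
      by (rule gKinv_weight [OF gF_weight [OF local_part_weight [OF F]]]) (simp add: \<mu>)
    then show ?case
      using left_span.F [OF local_part_scal [OF F]] by (simp add: scal_out)
  qed (simp add: ring_distribs left_span.add)
next
  case (5 c)
  then show ?case
  proof (induction rule: left_span.induct)
    case (E x i)
    then show ?case using left_span.E [OF local_part_scal [OF E]] by (simp add: scal_out)
  next
    case (F x i)
    then show ?case using left_span.F [OF local_part_scal [OF F]] by (simp add: scal_out)
  qed (simp add: ring_distribs left_span.add)
qed (simp_all add: ring_distribs mult.assoc left_span.add)

section \<open>The corner of \<open>e\<close>\<close>

text \<open>Evaluating \<open>e K x\<close> from the left and from the right gives two different
  multiples of \<open>e x\<close>.\<close>

lemma e_mult_weight:
  assumes "gK * x = scal c * x" "c \<noteq> \<mu>"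
  shows "e * x = 0"
proof -
  have "scal \<mu> * (e * x) = scal c * (e * x)"
    by (metis assms(1) eK mult.assoc mult_scal_left)
  then have "scal (\<mu> - c) * (e * x) = 0" by (simp add: scal_diff left_diff_distrib)
  then show ?thesis using assms(2) by (simp add: scal_mult_eq_0_iff)
qed

text \<open>For \<open>0 < i < p\<close> the weight changes by \<open>q^(2i)\<close> or its inverse,
  which is not \<open>1\<close>, so \<open>e\<close> kills the term; powers from \<open>p\<close> on
  vanish. Only \<open>i = 0\<close> survives.\<close>

lemma e_left_span:
  assumes "w \<in> left_span"
  shows "e * w \<in> local_part"
  using assms
proof (induction rule: left_span.induct)
  have zero: "0 \<in> local_part"
    unfolding local_part_def by (auto intro!: exI [of _ 0])
  have e_local: "e * x = x" if "x \<in> local_part" for x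
  proof -
    have "e * (N * e) = N * e" by (metis N_commute e mult.assoc)
    then show ?thesis
      using that unfolding local_part_def
      by (auto simp: ring_distribs mult_scal_left [of e] e)
  qed
  {
    case (E x i)
    consider "i = 0" | "0 < i" "i < CARD('p)" | "CARD('p) \<le> i" by linarith
    then show ?case
    proof cases
      case 1
      then show ?thesis using E e_local by simp
    next
      case 2
      then have "e * (gE ^ i * x) = 0"
        using qroot_power_neq_1 [of i "CARD('p)"] \<mu>
        by (intro e_mult_weight [OF gE_weight [OF local_part_weight [OF E]]]) simp
      then show ?thesis using zero by simp
    next
      case 3
      then have "gE ^ i = (0 :: 'p uq)"
        by (metis le_add_diff_inverse mult_zero_left power_add uq_relations(6))
      then show ?thesis using zero by simp
    qed
  next
    case (F x i)
    consider "i = 0" | "0 < i" "i < CARD('p)" | "CARD('p) \<le> i" by linarith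
    then show ?case
    proof cases
      case 1
      then show ?thesis using F e_local by simp
    next
      case 2
      then have "e * (gF ^ i * x) = 0"
        using qroot_power_neq_1 [of i "CARD('p)"] \<mu>
        by (intro e_mult_weight [OF gF_weight [OF local_part_weight [OF F]]])
          (simp add: power_inverse)
      then show ?thesis using zero by simp
    next
      case 3
      then have "gF ^ i = (0 :: 'p uq)"
        by (metis le_add_diff_inverse mult_zero_left power_add uq_relations(7))
      then show ?thesis using zero by simp
    qed
  next
    case (add x y)
    then show ?case by (simp add: ring_distribs local_part_add)
  }
qed

lemma corner_local: "e * x * e \<in> local_part"
proof -
  have "e = scal 1 * e + scal 0 * (N * e)" by simp
  then have "e \<in> local_part" unfolding local_part_def by blast
  then have "x * e \<in> left_span"
    using left_span_ideal left_span.E [of e 0] by simp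
  then show ?thesis using e_left_span by (simp add: mult.assoc)
qed

text \<open>For \<open>c + d X\<close> in the dual numbers, idempotence means \<open>c^2 = c\<close>
  and \<open>2 c d = d\<close>.\<close>

lemma idempotent_in_corner:
  assumes "e * f * e = f" "f * f = f"
  shows "f = 0 \<or> f = e"
proof -
  obtain c d where f: "f = scal c * e + scal d * (N * e)"
    using corner_local [of f] assms(1) unfolding local_part_def by auto
  have eN: "e * (N * e) = N * e" by (metis N_commute e mult.assoc)
  have ff: "f * f = scal (c * c) * e + (scal (c * d) * (N * e) + scal (c * d) * (N * e))"
  proof -
    have "f * f = scal c * (e * f) + scal d * (N * (e * f))"
      unfolding f [THEN arg_cong, of "\<lambda>x. x * f"] by (simp add: ring_distribs mult.assoc)
    also have "e * f = f"
      by (simp add: f ring_distribs mult_scal_left [of e] e eN)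
    also have "N * f = scal c * (N * e)"
      by (simp add: f ring_distribs mult_scal_left [of N] Ne)
    finally show ?thesis
      by (simp add: f ring_distribs scal_mult_left scal_add mult.commute)
  qed
  have *: "scal (c * c - c) * e + scal (c * d + c * d - d) * (N * e) = 0"
  proof -
    have "scal (c * c - c) * e + scal (c * d + c * d - d) * (N * e) = f * f - (scal c * e + scal d * (N * e))"
      unfolding ff scal_diff scal_add by (simp add: algebra_simps)
    then show ?thesis using assms(2) f by simp
  qed
  \<comment> \<open>Multiplying by \<open>N\<close> removes the second term and isolates
    \<open>c^2 - c\<close>.\<close>
  then have "N * (scal (c * c - c) * e + scal (c * d + c * d - d) * (N * e)) = 0" by simp
  then have cN: "scal (c * c - c) * (N * e) = 0"
    by (simp add: ring_distribs mult_scal_left [of N] Ne)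
  show ?thesis
  proof (cases "N * e = 0")
    case True
    then have "c * (c - 1) = 0 \<or> e = 0" using * by (simp add: scal_mult_eq_0_iff algebra_simps)
    then have "c = 0 \<or> c = 1 \<or> e = 0" by simp
    moreover have "f = scal c * e" using f True by simp
    ultimately show ?thesis by auto
  next
    case False
    then have "c * (c - 1) = 0" using cN by (simp add: scal_mult_eq_0_iff algebra_simps)
    then have c: "c = 0 \<or> c = 1" by simp
    \<comment> \<open>As \<open>c\<close> is \<open>0\<close> or \<open>1\<close>, the factor
      \<open>2 c - 1\<close> is nonzero and forces \<open>d = 0\<close>.\<close>
    then have "d * (c + c - 1) = 0" using * False by (auto simp: scal_mult_eq_0_iff algebra_simps)
    then have "d = 0" using c by auto
    then show ?thesis using f c by auto
  qed
qed

text \<open>Orthogonality puts \<open>f\<close> into the corner of \<open>e\<close>, so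
  \<open>f\<close> is \<open>0\<close> or \<open>e\<close>, and in the second case
  \<open>g = 0\<close>.\<close>

lemma primitive_in_corner:
  assumes "f * f = f" "g * g = g" "f * g = 0" "g * f = 0" "e = f + g"
  shows "f = 0 \<or> g = 0"
proof -
  have "e * f * e = f" using assms by (simp add: ring_distribs mult.assoc)
  then have "f = 0 \<or> f = e" using idempotent_in_corner assms(1) by blast
  then show ?thesis using assms(5) by auto
qed

end

section \<open>The elements \<open>e\<close> in their block\<close>

text \<open>The condition on \<open>r\<close> is met by \<open>r = s\<close> for sign
  \<open>1\<close> and by \<open>r = p - s\<close> for sign \<open>-1\<close>.\<close>

lemma ee_primitive:
  assumes p: "2 \<le> CARD('p::finite)" and \<alpha>: "\<alpha> * \<alpha> = 1" and s: "1 \<le> s" "s < CARD('p)"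
    and t: "1 \<le> t" "t \<le> s" and r: "\<alpha> * casimir_eigenvalue CARD('p) s = casimir_eigenvalue CARD('p) r"
  shows "primitive_idempotent_in (block r) (ee \<alpha> s t :: 'p uq)"
proof -
  let ?e = "ee \<alpha> s t :: 'p uq" and ?l = "wt CARD('p) \<alpha> s t" and ?N = "cas_nil \<alpha> s :: 'p uq"
  obtain G where G: "?e = poly_uq G ?N * (scal (1 / (2 * of_nat CARD('p))) * vv \<alpha> s t)"
    and ee: "?e * ?e = ?e" and N: "?N * (?N * ?e) = 0"
    using ee_as_poly [OF p \<alpha> s t] by metis
  have Nc: "poly_uq G ?N * x = x * poly_uq G ?N" for x
    by (rule poly_uq_cas_nil_commute [OF p])
  have v: "gK * vv \<alpha> s t = scal ?l * (vv \<alpha> s t :: 'p uq)" by (rule vv_weight [OF \<alpha>])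
  have "gK * ?e = poly_uq G ?N * (scal (1 / (2 * of_nat CARD('p))) * (gK * vv \<alpha> s t))"
    unfolding G by (metis Nc mult.assoc mult_scal_left)
  also have "\<dots> = scal ?l * ?e"
    unfolding v G by (metis mult.assoc mult_scal_left)
  finally have Ke: "gK * ?e = scal ?l * ?e" .
  \<comment> \<open>\<open>v\<close> commutes with \<open>K\<close>, so \<open>e\<close> has the
    same weight on the right.\<close>
  have "?e * gK = poly_uq G ?N * (scal (1 / (2 * of_nat CARD('p))) * (gK * vv \<alpha> s t))"
    unfolding G vv_commute by (simp add: mult.assoc)
  also have "\<dots> = scal ?l * ?e"
    unfolding v G by (metis mult.assoc mult_scal_left)
  finally have eK: "?e * gK = scal ?l * ?e" .
  have "(casimir - scal (casimir_eigenvalue CARD('p) r)) ^ 2 * ?e = 0"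
    using N by (simp add: cas_nil_def r power2_eq_square mult.assoc)
  then have "?e \<in> block r" unfolding block_def by blast
  moreover have "?e \<noteq> 0"
    using ee_neq_0 [OF p \<alpha> _ t s(2)] s by simp
  ultimately show ?thesis
    unfolding primitive_idempotent_in_def
    using ee primitive_in_corner [OF p HOL.refl ee N wt_neq_0 [OF \<alpha>] Ke eK] by blast
qed

text \<open>As \<open>v\<close> commutes with \<open>K\<close>, both weights are eigenvalues of
  \<open>K\<close> on \<open>v w\<close>, so \<open>v w = 0\<close>; the polynomials in central
  elements move out of the way.\<close>

lemma ee_orthogonal:
  assumes p: "2 \<le> CARD('p::finite)" and \<alpha>: "\<alpha> * \<alpha> = 1" and s: "1 \<le> s" "s < CARD('p)"
    and t: "1 \<le> t" "t \<le> s" and \<beta>: "\<beta> * \<beta> = 1" and r: "1 \<le> r" "r < CARD('p)"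
    and u: "1 \<le> u" "u \<le> r" and ne: "wt CARD('p) \<alpha> s t \<noteq> wt CARD('p) \<beta> r u"
  shows "ee \<alpha> s t * ee \<beta> r u = (0 :: 'p uq)"
proof -
  let ?v = "vv \<alpha> s t :: 'p uq" and ?w = "vv \<beta> r u :: 'p uq"
  let ?l = "wt CARD('p) \<alpha> s t" and ?m = "wt CARD('p) \<beta> r u"
  have "scal ?l * (?v * ?w) = scal ?m * (?v * ?w)"
    by (metis vv_weight [OF \<alpha>] vv_weight [OF \<beta>] vv_commute mult.assoc mult_scal_left)
  then have "scal (?l - ?m) * (?v * ?w) = 0" by (simp add: scal_diff left_diff_distrib)
  then have vw: "?v * ?w = 0" using ne by (simp add: scal_mult_eq_0_iff)
  obtain G where G: "ee \<alpha> s t = poly_uq G (cas_nil \<alpha> s) * (scal (1 / (2 * of_nat CARD('p))) * ?v)"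
    using ee_as_poly [OF p \<alpha> s t] by metis
  obtain H where H: "ee \<beta> r u = poly_uq H (cas_nil \<beta> r) * (scal (1 / (2 * of_nat CARD('p))) * ?w)"
    using ee_as_poly [OF p \<beta> r u] by metis
  have "?v * (poly_uq H (cas_nil \<beta> r) * (scal (1 / (2 * of_nat CARD('p))) * ?w)) =
      poly_uq H (cas_nil \<beta> r) * (scal (1 / (2 * of_nat CARD('p))) * (?v * ?w))"
    by (metis poly_uq_cas_nil_commute [OF p] mult.assoc mult_scal_left)
  then show ?thesis unfolding G H by (simp add: mult.assoc vw)
qed

theorem proposition4p9:
  fixes s :: nat and e :: "complex \<times> nat \<times> nat \<Rightarrow> 'p::finite uq"
    and I :: "(complex \<times> nat \<times> nat) set"
  assumes "2 \<le> CARD('p)" and "1 \<le> s" and "s \<le> CARD('p) - 1"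
  defines "I \<equiv> {(1, s, t) | t. 1 \<le> t \<and> t \<le> s} \<union>
                {(- 1, CARD('p) - s, u) | u. 1 \<le> u \<and> u \<le> CARD('p) - s}"
    and "e \<equiv> \<lambda>(\<alpha>, r, t). ee \<alpha> r t"
  shows "(\<forall>i\<in>I. primitive_idempotent_in (block s) (e i)) \<and>
         (\<forall>i\<in>I. \<forall>j\<in>I. i \<noteq> j \<longrightarrow> e i * e j = 0)"
proof -
  \<comment> \<open>The place of each weight in the list \<open>wt p 1 s 1\<close> to
    \<open>wt p 1 s p\<close>; by \<open>wt_flip\<close> the family of sign \<open>-1\<close>
    follows after place \<open>s\<close>.\<close>
  define pos where "pos = (\<lambda>(\<alpha> :: complex, r :: nat, t). if \<alpha> = 1 then t else s + t)"
  have sp: "s < CARD('p)" "s \<le> CARD('p)" "0 < CARD('p)" using assms(1-3) by auto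
  have I: "\<exists>\<alpha> r t. i = (\<alpha>, r, t) \<and> \<alpha> * \<alpha> = 1 \<and> 1 \<le> r \<and> r < CARD('p) \<and> 1 \<le> t \<and> t \<le> r \<and>
      \<alpha> * casimir_eigenvalue CARD('p) r = casimir_eigenvalue CARD('p) s \<and>
      wt CARD('p) \<alpha> r t = wt CARD('p) 1 s (pos i) \<and> 1 \<le> pos i \<and> pos i \<le> CARD('p)"
    if "i \<in> I" for i
    using that assms(2) sp casimir_eigenvalue_flip [OF sp(2,3)] wt_flip [OF sp(2,3)]
    unfolding I_def by (auto simp: pos_def)
  have inj: "i = j" if "i \<in> I" "j \<in> I" "pos i = pos j" for i j
    using that unfolding I_def by (auto simp: pos_def)
  have "primitive_idempotent_in (block s) (e i)" if "i \<in> I" for i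
    using I [OF that] ee_primitive [OF assms(1)] by (auto simp: e_def)
  moreover have "e i * e j = 0" if ij: "i \<in> I" "j \<in> I" "i \<noteq> j" for i j
  proof -
    \<comment> \<open>Different places between \<open>1\<close> and \<open>p\<close> differ by less
      than \<open>p\<close>, as \<open>wt_neq\<close> requires.\<close>
    have "wt CARD('p) 1 s (pos i) \<noteq> wt CARD('p) 1 s (pos j)"
      using inj [OF ij(1,2)] ij(3) I [OF ij(1)] I [OF ij(2)]
        wt_neq [of 1 "pos i" "pos j" "CARD('p)" s] wt_neq [of 1 "pos j" "pos i" "CARD('p)" s]
      by (cases "pos i < pos j") force+
    then show ?thesis
      using I [OF ij(1)] I [OF ij(2)] ee_orthogonal [OF assms(1)] by (auto simp: e_def)
  qed
  ultimately show ?thesis by blast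
qed

end
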